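(* Let $d\ge1$ be an integer, $A,\bar A\in\mathbb R^{n\times n}$, $B,\bar B\in\mathbb R^{n\times m}$. For given $K\in\mathbb R^{m\times n}$ and symmetric $Q\in\mathbb R^{n\times n}$ with $Q\ge0$, assume that $(A-BK,\bar A-\bar BK\,|\,Q^{1/2})$ is exactly observable. If the closed-loop system $x_{k+1}=A_kx_k-B_kKx_k|_{k-d-1}$, with $A_k=A+w_k\bar A$ and $B_k=B+w_k\bar B$, is asymptotically mean-square stable, then the Lyapunov-type equations $$P^{i-1}=A'P^{i}A+\bar A'P^0\bar A+Q,\qquad i=1,\dots,d,$$ $$P^d=(A-BK)'P^d(A-BK)+(\bar A-\bar BK)'P^0(\bar A-\bar BK)+Q$$ in the unknowns $P^0,\dots,P^d\in\mathbb R^{n\times n}$ have a unique positive definite solution ($P^i>0$ for $i=0,\dots,d$).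
   Context: Notation. A prime denotes transpose; $M>0$ ($M\ge0$) means symmetric positive definite (semi-definite). $\{w_k\}_{k\ge0}$ is a scalar white-noise sequence (independent random variables) with zero mean and $\mathsf E[w_kw_s]=\delta_{ks}$; $\mathcal F_k=\sigma(w_0,\dots,w_k)$ for $k\ge0$, and $\mathcal F_k$ is trivial for $k<0$. $x_k|_m=\mathsf E[x_k\mid\mathcal F_m]$. Closed loop and stability. The open-loop system is $x_{k+1}=A_kx_k+B_ku_{k-d}$, $k\ge0$, with deterministic initial data $x_0,u_{-d},\dots,u_{-1}$; the closed loop is obtained with $u_{k-d}=-Kx_k|_{k-d-1}$ for $k\ge d$. It is asymptotically mean-square stable if $\lim_{k\to\infty}\mathsf E[x_k'x_k]=0$ for all initial data $x_0,u_{-d},\dots,u_{-1}$. Exact observability. $(A-BK,\bar A-\bar BK\,|\,Q^{1/2})$ is exactly observable if for every initial time $j\ge d$ and every square-integrable $\mathcal F_{j-1}$-measurable $x_j$, the solution of $x_{k+1}=A_kx_k-B_kKx_k|_{k-d-1}$, $k\ge j$, with output $y_k=Q^{1/2}x_k$ satisfies: if $y_k=0$ a.s. on $j\le k\le N$ for every $N\ge j$, then $x_j=0$ a.s. *)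

theory Defs
  imports "HOL-Probability.Probability"
begin

definition pos_semidef :: "real^'n^'n \<Rightarrow> bool" where
  "pos_semidef S \<longleftrightarrow> transpose S = S \<and> (\<forall>x. 0 \<le> x \<bullet> (S *v x))"

definition pos_def :: "real^'n^'n \<Rightarrow> bool" where
  "pos_def S \<longleftrightarrow> transpose S = S \<and> (\<forall>x. x \<noteq> 0 \<longrightarrow> 0 < x \<bullet> (S *v x))"

(* Meaningful for positive semidefinite Q, where the root exists and is unique. *)
definition psd_sqrt :: "real^'n^'n \<Rightarrow> real^'n^'n" where
  "psd_sqrt Q = (THE R. pos_semidef R \<and> R ** R = Q)"

definition white_noise :: "'a measure \<Rightarrow> (nat \<Rightarrow> 'a \<Rightarrow> real) \<Rightarrow> bool" where
  "white_noise M w \<longleftrightarrow>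
     prob_space M \<and>
     prob_space.indep_vars M (\<lambda>_. borel) w UNIV \<and>
     (\<forall>k. integrable M (\<lambda>\<omega>. (w k \<omega>)\<^sup>2)) \<and>
     (\<forall>k. (\<integral>\<omega>. w k \<omega> \<partial>M) = 0) \<and>
     (\<forall>k s. (\<integral>\<omega>. w k \<omega> * w s \<omega> \<partial>M) = (if k = s then 1 else 0))"

(* The sigma-algebra generated by w 0, ..., w m.  Integer indices: for m < 0 there are
   no generators and the sigma-algebra is trivial. *)
definition noise_filtration :: "'a measure \<Rightarrow> (nat \<Rightarrow> 'a \<Rightarrow> real) \<Rightarrow> int \<Rightarrow> 'a measure" where
  "noise_filtration M w m =
     sigma (space M) {w s -` S \<inter> space M | s S. int s \<le> m \<and> S \<in> sets borel}"

definition vec_cond_exp :: "'a measure \<Rightarrow> 'a measure \<Rightarrow> ('a \<Rightarrow> real^'n) \<Rightarrow> 'a \<Rightarrow> real^'n" where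
  "vec_cond_exp M F x = (\<lambda>\<omega>. \<chi> i. real_cond_exp M F (\<lambda>\<omega>'. x \<omega>' $ i) \<omega>)"

context
  fixes M :: "'a measure" and w :: "nat \<Rightarrow> 'a \<Rightarrow> real" and d :: nat
    and A Abar :: "real^'n^'n" and B Bbar :: "real^'m^'n" and K :: "real^'n^'m"
begin

(* One step of x (k+1) = A_k x_k + B_k v, where v is the delayed input u (k-d). *)
definition plant_step ::
    "nat \<Rightarrow> ('a \<Rightarrow> real^'n) \<Rightarrow> ('a \<Rightarrow> real^'m) \<Rightarrow> 'a \<Rightarrow> real^'n" where
  "plant_step k x v =
     (\<lambda>\<omega>. (A + w k \<omega> *\<^sub>R Abar) *v x \<omega> + (B + w k \<omega> *\<^sub>R Bbar) *v v \<omega>)"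

(* The delayed input u (k-d) = - K E[x_k | F (k-d-1)] applied at time k \<ge> d. *)
definition delayed_feedback :: "nat \<Rightarrow> ('a \<Rightarrow> real^'n) \<Rightarrow> 'a \<Rightarrow> real^'m" where
  "delayed_feedback k x =
     (\<lambda>\<omega>. - (K *v vec_cond_exp M (noise_filtration M w (int k - int d - 1)) x \<omega>))"

(* Only the values u (-d), ..., u (-1) of the initial input are used. *)
primrec closed_loop :: "real^'n \<Rightarrow> (int \<Rightarrow> real^'m) \<Rightarrow> nat \<Rightarrow> 'a \<Rightarrow> real^'n" where
  "closed_loop x0 u 0 = (\<lambda>_. x0)"
| "closed_loop x0 u (Suc k) =
     plant_step k (closed_loop x0 u k)
       (if k < d then (\<lambda>_. u (int k - int d)) else delayed_feedback k (closed_loop x0 u k))"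

definition asymp_ms_stable :: bool where
  "asymp_ms_stable \<longleftrightarrow>
     (\<forall>x0 u. (\<lambda>k. \<integral>\<omega>. closed_loop x0 u k \<omega> \<bullet> closed_loop x0 u k \<omega> \<partial>M) \<longlonglongrightarrow> 0)"

(* closed_loop_from j \<xi> t is the state at time j + t of the solution with state \<xi> at time j. *)
primrec closed_loop_from :: "nat \<Rightarrow> ('a \<Rightarrow> real^'n) \<Rightarrow> nat \<Rightarrow> 'a \<Rightarrow> real^'n" where
  "closed_loop_from j \<xi> 0 = \<xi>"
| "closed_loop_from j \<xi> (Suc t) =
     plant_step (j + t) (closed_loop_from j \<xi> t)
       (delayed_feedback (j + t) (closed_loop_from j \<xi> t))"

definition exactly_observable :: "real^'n^'n \<Rightarrow> bool" where
  "exactly_observable C \<longleftrightarrow>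
     (\<forall>j \<xi>. d \<le> j \<longrightarrow>
        \<xi> \<in> borel_measurable (noise_filtration M w (int j - 1)) \<longrightarrow>
        integrable M (\<lambda>\<omega>. (norm (\<xi> \<omega>))\<^sup>2) \<longrightarrow>
        (\<forall>N\<ge>j. \<forall>k\<in>{j..N}. AE \<omega> in M. C *v closed_loop_from j \<xi> (k - j) \<omega> = 0) \<longrightarrow>
        (AE \<omega> in M. \<xi> \<omega> = 0))"

end

definition lyapunov_equations ::
    "nat \<Rightarrow> real^'n^'n \<Rightarrow> real^'n^'n \<Rightarrow> real^'m^'n \<Rightarrow> real^'m^'n \<Rightarrow> real^'n^'m \<Rightarrow> real^'n^'n
      \<Rightarrow> (nat \<Rightarrow> real^'n^'n) \<Rightarrow> bool" where
  "lyapunov_equations d A Abar B Bbar K Q P \<longleftrightarrow>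
     (\<forall>i\<in>{1..d}. P (i - 1) =
        transpose A ** P i ** A + transpose Abar ** P 0 ** Abar + Q) \<and>
     P d = transpose (A - B ** K) ** P d ** (A - B ** K)
         + transpose (Abar - Bbar ** K) ** P 0 ** (Abar - Bbar ** K) + Q"

end

theory Submission
  imports Defs
begin

text \<open>
  Expand every state in the orthonormal system of products $w_S = \prod_{s \in S} w_s$.  Conditioning
  on the past keeps or deletes whole terms, so each coefficient moves deterministically: a term whose
  last noise is younger than the delay is driven by $(A, \bar A)$, an older one by
  $(A - BK, \bar A - \bar BK)$.  Hence $\mathsf E[x_k' R x_k]$ is computed by iterating the operator
  of the Lyapunov equations on quadratic forms.  The free initial inputs let deterministic initial
  data imitate a component of any age, so mean-square stability makes the iterates of the operator
  tend to zero.  This yields uniqueness, and a supersolution that bounds the increasing iteration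
  $P \mapsto \Lambda P + Q$, hence existence.  A vector in the kernel of some $P^i$ starts a trajectory
  with zero output, so exact observability makes $P^i$ definite.
\<close>

section \<open>Square roots of positive semidefinite matrices\<close>

text \<open>The feedback sees only a conditional mean of the state, so the second moment of the
  state obeys no recursion of its own: part of the state is visible to the controller, part is not,
  and the split moves with time. Sorting the squared chaos coefficients by age gives a closed
  recursion with \<open>d + 1\<close> classes. Class \<open>i\<close> passes to
  \<open>i + 1\<close>, class \<open>d\<close> keeps its members, and fresh noise sends a copy of
  every class to class 0. Hence there are \<open>d + 1\<close> unknowns and \<open>P 0\<close> sits
  in every equation: \<open>P i\<close> is the total future output cost of a component of age
  \<open>i\<close>. The order arguments run on real-valued functions of a vector, where only
  monotonicity and homogeneity of the operator count; polarisation leads back to matrices when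
  limits and equalities are taken. Stability concerns deterministic data at time 0 and observability
  random data from time \<open>d\<close> on, so the two hypotheses enter through different
  trajectories. The root \<open>psd_sqrt\<close> is a definite description, so its existence and
  uniqueness come before any use of observability.\<close>

lemma inner_symmetric_matrix:
  fixes S :: "real^'n^'n"
  assumes "transpose S = S"
  shows "x \<bullet> (S *v y) = (S *v x) \<bullet> y"
  by (metis assms dot_lmul_matrix vector_transpose_matrix)

lemma symmetric_matrixI:
  fixes S :: "real^'n^'n"
  assumes "\<And>x y. x \<bullet> (S *v y) = (S *v x) \<bullet> y"
  shows "transpose S = S"
proof -
  have "S $ i $ j = S $ j $ i" for i j
    using assms[of "axis i 1" "axis j 1"]
    by (simp add: matrix_vector_mult_basis inner_axis inner_axis' column_def)
  then show ?thesis by (simp add: vec_eq_iff transpose_def)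
qed

text \<open>A maximiser of the Rayleigh quotient on the unit sphere of \<open>V\<close> is an
  eigenvector, because the first variation vanishes there.\<close>

lemma symmetric_matrix_eigenvector:
  fixes S :: "real^'n^'n"
  assumes S: "transpose S = S" and V: "subspace V" "\<And>x. x \<in> V \<Longrightarrow> S *v x \<in> V"
    and ne: "V \<noteq> {0}"
  obtains v l where "v \<in> V" "norm v = 1" "S *v v = l *\<^sub>R v"
proof -
  let ?C = "sphere 0 1 \<inter> V"
  obtain x where x: "x \<in> V" "x \<noteq> 0"
    using ne V(1) subspace_0 by blast
  then have "x /\<^sub>R norm x \<in> ?C"
    using V(1) by (auto simp: subspace_scale)
  then have "?C \<noteq> {}" by blast
  moreover have "compact ?C"
    using V(1) by (intro compact_Int_closed closed_subspace) auto
  moreover have "continuous_on ?C (\<lambda>x. x \<bullet> (S *v x))"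
    by (intro continuous_intros)
  ultimately obtain v where v: "v \<in> ?C" and max: "\<And>y. y \<in> ?C \<Longrightarrow> y \<bullet> (S *v y) \<le> v \<bullet> (S *v v)"
    using continuous_attains_sup[of ?C "\<lambda>x. x \<bullet> (S *v x)"] by blast
  define l where "l = v \<bullet> (S *v v)"
  have le: "y \<bullet> (S *v y) \<le> l * (y \<bullet> y)" if "y \<in> V" for y
  proof (cases "y = 0")
    case False
    have "y /\<^sub>R norm y \<in> ?C"
      using V(1) that False by (auto simp: subspace_scale)
    from max[OF this] show ?thesis
      using False unfolding l_def
      by (simp add: matrix_vector_mult_scaleR power2_norm_eq_inner[symmetric] field_simps power2_eq_square)
  qed auto
  \<comment> \<open>The residual of the eigenvalue equation serves as the direction of variation; it
    lies in \<open>V\<close> by invariance.\<close>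
  define u where "u = S *v v - l *\<^sub>R v"
  define a where "a = u \<bullet> u"
  define c where "c = l * (u \<bullet> u) - u \<bullet> (S *v u)"
  have uV: "u \<in> V" unfolding u_def using V v by (auto intro: subspace_diff subspace_scale)
  then have c: "c \<ge> 0" using le[of u] by (simp add: c_def)
  have vv: "v \<bullet> v = 1" using v by (simp add: dot_square_norm)
  have q: "0 \<le> t\<^sup>2 * c - 2 * t * a" for t
  proof -
    have "v + t *\<^sub>R u \<in> V" using uV v V by (auto intro: subspace_add subspace_scale)
    from le[OF this]
    have "0 \<le> l * (1 + 2 * t * (u \<bullet> v) + t\<^sup>2 * (u \<bullet> u)) - (l + t * (u \<bullet> (S *v v)) + t * (v \<bullet> (S *v u)) + t\<^sup>2 * (u \<bullet> (S *v u)))"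
      by (simp add: matrix_vector_right_distrib matrix_vector_mult_scaleR inner_add_left inner_add_right
          vv l_def[symmetric] inner_commute[of v u] power2_eq_square algebra_simps)
    also have "v \<bullet> (S *v u) = u \<bullet> (S *v v)"
      using inner_symmetric_matrix[OF S, of v u] by (simp add: inner_commute)
    also have "u \<bullet> (S *v v) = a + l * (u \<bullet> v)"
      by (simp add: a_def u_def inner_diff_right algebra_simps)
    finally show ?thesis by (simp add: c_def algebra_simps)
  qed
  have "a = 0"
  proof (rule ccontr)
    assume "a \<noteq> 0"
    then have a: "a > 0" by (simp add: a_def)
    \<comment> \<open>A step small enough for the linear term of \<open>q\<close> to dominate the
      quadratic one; the \<open>+ 1\<close> covers \<open>c = 0\<close>.\<close>
    define t where "t = a / (c + 1)"
    have t: "t > 0" "a = t * (c + 1)" using a c by (auto simp: t_def)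
    have "0 \<le> t\<^sup>2 * c - 2 * t * a" by (rule q)
    also have "\<dots> = t\<^sup>2 * (- c - 2)"
      using t(2) by (simp add: power2_eq_square algebra_simps)
    also have "\<dots> < 0" using t(1) c by (intro mult_pos_neg) auto
    finally show False by simp
  qed
  then have "S *v v = l *\<^sub>R v" by (simp add: a_def u_def)
  with v that show thesis by auto
qed

text \<open>Completeness is stated as the Fourier expansion, the form in which the root is later
  built and compared. Working relative to \<open>V\<close> makes induction on the dimension
  possible.\<close>

definition orthonormal_eigenbasis ::
    "real^'n^'n \<Rightarrow> (real^'n) set \<Rightarrow> (real^'n) set \<Rightarrow> (real^'n \<Rightarrow> real) \<Rightarrow> bool" where
  "orthonormal_eigenbasis S V E l \<longleftrightarrow> finite E \<and> E \<subseteq> V \<and>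
     (\<forall>b\<in>E. \<forall>b'\<in>E. b \<bullet> b' = (if b = b' then 1 else 0)) \<and>
     (\<forall>b\<in>E. S *v b = l b *\<^sub>R b) \<and> (\<forall>x\<in>V. (\<Sum>b\<in>E. (b \<bullet> x) *\<^sub>R b) = x)"

text \<open>Split off one eigenvector: by symmetry its orthogonal complement inside \<open>V\<close>
  is again invariant, and its dimension is smaller.\<close>

lemma symmetric_matrix_eigenbasis_subspace:
  fixes S :: "real^'n^'n"
  assumes S: "transpose S = S" and V: "subspace V" "\<And>x. x \<in> V \<Longrightarrow> S *v x \<in> V"
  shows "\<exists>E l. orthonormal_eigenbasis S V E l"
  using V
proof (induction "dim V" arbitrary: V rule: less_induct)
  case less
  show ?case
  proof (cases "V = {0}")
    case True
    then show ?thesis by (intro exI[of _ "{}"]) (auto simp: orthonormal_eigenbasis_def)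
  next
    case False
    obtain v m where v: "v \<in> V" "norm v = 1" "S *v v = m *\<^sub>R v"
      using symmetric_matrix_eigenvector[OF S less.prems False] by blast
    have vv: "v \<bullet> v = 1" using v by (simp add: dot_square_norm)
    let ?W = "V \<inter> {y. v \<bullet> y = 0}"
    have W: "subspace ?W"
      using less.prems(1) by (intro subspace_inter subspace_hyperplane)
    have "?W \<subset> V" using v vv by force
    then have "dim ?W < dim V"
      using W less.prems(1) by (intro dim_psubset) (simp add: span_eq_iff[THEN iffD2])
    moreover have "S *v x \<in> ?W" if "x \<in> ?W" for x
      using that less.prems(2) v inner_symmetric_matrix[OF S, of v x] by auto
    ultimately obtain E l where "orthonormal_eigenbasis S ?W E l"
      using less.hyps[OF _ W] by blast
    then have E: "finite E" "E \<subseteq> ?W"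
      "\<And>b b'. b \<in> E \<Longrightarrow> b' \<in> E \<Longrightarrow> b \<bullet> b' = (if b = b' then 1 else 0)"
      "\<And>b. b \<in> E \<Longrightarrow> S *v b = l b *\<^sub>R b" "\<And>x. x \<in> ?W \<Longrightarrow> (\<Sum>b\<in>E. (b \<bullet> x) *\<^sub>R b) = x"
      unfolding orthonormal_eigenbasis_def by blast+
    have vE: "v \<notin> E" using E(2) vv by auto
    have exp: "(\<Sum>b\<in>insert v E. (b \<bullet> x) *\<^sub>R b) = x" if "x \<in> V" for x
    proof -
      have "x - (v \<bullet> x) *\<^sub>R v \<in> ?W"
        using that v less.prems(1) vv by (auto intro: subspace_diff subspace_scale simp: inner_diff_right)
      then have "x - (v \<bullet> x) *\<^sub>R v = (\<Sum>b\<in>E. (b \<bullet> (x - (v \<bullet> x) *\<^sub>R v)) *\<^sub>R b)"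
        by (simp only: E(5))
      also have "\<dots> = (\<Sum>b\<in>E. (b \<bullet> x) *\<^sub>R b)"
        using E(2) by (intro sum.cong) (auto simp: inner_diff_right inner_commute[of _ v])
      finally show ?thesis using E(1) vE by (simp add: algebra_simps)
    qed
    have "b \<bullet> b' = (if b = b' then 1 else 0)" if "b \<in> insert v E" "b' \<in> insert v E" for b b'
    proof -
      have "v \<bullet> y = 0" "y \<bullet> v = 0" if "y \<in> E" for y
        using that E(2) by (auto simp: inner_commute)
      then show ?thesis using that E(3) vv vE by (metis insertE)
    qed
    moreover have "S *v b = (l(v := m)) b *\<^sub>R b" if "b \<in> insert v E" for b
      using that E(4) v(3) vE by (metis fun_upd_apply insertE)
    ultimately have "orthonormal_eigenbasis S V (insert v E) (l(v := m))"
      using E(1,2) v(1) exp unfolding orthonormal_eigenbasis_def by blast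
    then show ?thesis by blast
  qed
qed

lemma matrix_eqI_on_eigenbasis:
  fixes R T :: "real^'n^'n"
  assumes "\<And>x. (\<Sum>b\<in>E. (b \<bullet> x) *\<^sub>R b) = x" "\<And>b. b \<in> E \<Longrightarrow> R *v b = T *v b"
  shows "R = T"
proof -
  have "R *v x = T *v x" for x
  proof -
    have "R *v (\<Sum>b\<in>E. (b \<bullet> x) *\<^sub>R b) = T *v (\<Sum>b\<in>E. (b \<bullet> x) *\<^sub>R b)"
      using assms(2) by (simp add: linear_sum[OF matrix_vector_mul_linear] matrix_vector_mult_scaleR)
    then show ?thesis using assms(1)[of x] by simp
  qed
  then show ?thesis by (simp add: matrix_eq)
qed

text \<open>This forces uniqueness of the root. The residual \<open>?y\<close> satisfies
  \<open>R *v ?y = - (sqrt l *\<^sub>R ?y)\<close>, and a semidefinite matrix has no negative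
  eigenvalue. For \<open>l = 0\<close> this says nothing, and the norm of \<open>R *v b\<close> is
  computed instead.\<close>

lemma pos_semidef_root_eigenvector:
  fixes R :: "real^'n^'n"
  assumes R: "pos_semidef R" and eig: "(R ** R) *v b = l *\<^sub>R b" and l: "0 \<le> l"
  shows "R *v b = sqrt l *\<^sub>R b"
proof -
  let ?y = "R *v b - sqrt l *\<^sub>R b"
  have RR: "R *v (R *v b) = l *\<^sub>R b" using eig by (simp add: matrix_vector_mul_assoc)
  have sym: "transpose R = R" and psd: "\<And>x. 0 \<le> x \<bullet> (R *v x)" using R by (auto simp: pos_semidef_def)
  have y: "R *v ?y = - (sqrt l *\<^sub>R ?y)"
    using l by (simp add: matrix_vector_mult_diff_distrib matrix_vector_mult_scaleR RR algebra_simps)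
  have "?y \<bullet> ?y = 0"
  proof (cases "l = 0")
    case True
    then have "(R *v b) \<bullet> (R *v b) = 0"
      using inner_symmetric_matrix[OF sym, of b "R *v b"] RR by simp
    then show ?thesis using True by simp
  next
    case False
    have "sqrt l * (?y \<bullet> ?y) \<le> 0" using psd[of ?y] unfolding y by simp
    then show ?thesis using False l
      by (smt (verit) inner_ge_zero mult_pos_pos real_sqrt_gt_0_iff)
  qed
  then show ?thesis by simp
qed

lemma pos_semidef_sqrt_unique_existence:
  fixes Q :: "real^'n^'n"
  assumes Q: "pos_semidef Q"
  shows "\<exists>!R. pos_semidef R \<and> R ** R = Q"
proof -
  have sym: "transpose Q = Q" and psd: "\<And>x. 0 \<le> x \<bullet> (Q *v x)" using Q by (auto simp: pos_semidef_def)
  obtain E l where "orthonormal_eigenbasis Q UNIV E l"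
    using symmetric_matrix_eigenbasis_subspace[OF sym subspace_UNIV] by auto
  then have E: "finite E" "\<And>b b'. b \<in> E \<Longrightarrow> b' \<in> E \<Longrightarrow> b \<bullet> b' = (if b = b' then 1 else 0)"
    "\<And>b. b \<in> E \<Longrightarrow> Q *v b = l b *\<^sub>R b" "\<And>x. (\<Sum>b\<in>E. (b \<bullet> x) *\<^sub>R b) = x"
    unfolding orthonormal_eigenbasis_def by blast+
  have l: "0 \<le> l b" if "b \<in> E" for b
    using psd[of b] E(2)[OF that that] E(3)[OF that] by simp
  define r where "r x = (\<Sum>b\<in>E. (sqrt (l b) * (b \<bullet> x)) *\<^sub>R b)" for x
  have "linear r"
    unfolding r_def by (auto intro!: linearI simp: inner_add_right scaleR_sum_right sum.distrib algebra_simps)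
  define R where "R = matrix r"
  have Rv: "R *v x = r x" for x using \<open>linear r\<close> by (simp add: R_def)
  have Rb: "R *v b = sqrt (l b) *\<^sub>R b" if "b \<in> E" for b
  proof -
    have "R *v b = (\<Sum>b'\<in>E. if b' = b then sqrt (l b) *\<^sub>R b else 0)"
      unfolding Rv r_def using that by (intro sum.cong) (auto simp: E(2))
    then show ?thesis using E(1) that by simp
  qed
  have "transpose R = R"
  proof (rule symmetric_matrixI)
    fix x y
    have "x \<bullet> (R *v y) = (\<Sum>b\<in>E. sqrt (l b) * (b \<bullet> y) * (x \<bullet> b))"
      unfolding Rv r_def inner_sum_right by simp
    also have "\<dots> = (\<Sum>b\<in>E. sqrt (l b) * (b \<bullet> x) * (b \<bullet> y))"
      by (intro sum.cong refl) (simp add: inner_commute)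
    also have "\<dots> = (R *v x) \<bullet> y"
      unfolding Rv r_def inner_sum_left by simp
    finally show "x \<bullet> (R *v y) = (R *v x) \<bullet> y" .
  qed
  moreover have "0 \<le> x \<bullet> (R *v x)" for x
    unfolding Rv r_def inner_sum_right
    by (intro sum_nonneg) (auto simp: inner_commute[of x] mult.assoc l intro!: mult_nonneg_nonneg)
  moreover have RR: "R ** R = Q"
    by (rule matrix_eqI_on_eigenbasis[of E])
      (use E(4) in \<open>auto simp: matrix_vector_mul_assoc[symmetric] Rb E(3) l matrix_vector_mult_scaleR\<close>)
  ultimately have "pos_semidef R \<and> R ** R = Q" by (simp add: pos_semidef_def)
  moreover have "T = R" if "pos_semidef T \<and> T ** T = Q" for T
    using that pos_semidef_root_eigenvector[of T] E(3,4) l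
    by (intro matrix_eqI_on_eigenbasis[of E]) (auto simp: Rb)
  ultimately show ?thesis by blast
qed

text \<open>Translates vanishing output cost, which the operator computes, into vanishing output,
  which observability speaks of.\<close>

lemma psd_sqrt_vector_eq_0:
  fixes Q :: "real^'n^'n"
  assumes "pos_semidef Q" "x \<bullet> (Q *v x) = 0"
  shows "psd_sqrt Q *v x = 0"
proof -
  let ?R = "psd_sqrt Q"
  have R: "pos_semidef ?R" "?R ** ?R = Q"
    using theI'[OF pos_semidef_sqrt_unique_existence[OF assms(1)]] unfolding psd_sqrt_def by blast+
  have "(?R *v x) \<bullet> (?R *v x) = x \<bullet> (Q *v x)"
    using inner_symmetric_matrix[of ?R x "?R *v x"] R by (simp add: pos_semidef_def matrix_vector_mul_assoc)
  then show ?thesis using assms(2) by simp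
qed

section \<open>The Lyapunov operator on quadratic forms\<close>

text \<open>The index is an age: below \<open>d\<close> the controller cannot see the component, at
  \<open>d\<close> the loop is closed. The same definition serves the drift pair and the noise
  pair.\<close>

definition mode :: "nat \<Rightarrow> real^'n^'n \<Rightarrow> real^'m^'n \<Rightarrow> real^'n^'m \<Rightarrow> nat \<Rightarrow> real^'n^'n" where
  "mode d A B K i = (if i < d then A else A - B ** K)"

lemma symmetric_matrix_eqI:
  fixes S T :: "real^'n^'n"
  assumes "transpose S = S" "transpose T = T" "\<And>x. x \<bullet> (S *v x) = x \<bullet> (T *v x)"
  shows "S = T"
proof -
  have "x \<bullet> (S *v y) = x \<bullet> (T *v y)" for x y
    using assms(3)[of "x + y"] assms(3)[of x] assms(3)[of y]
      inner_symmetric_matrix[OF assms(1), of x y] inner_symmetric_matrix[OF assms(2), of x y]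
      inner_commute[of y "S *v x"] inner_commute[of y "T *v x"]
    by (simp add: matrix_vector_right_distrib inner_add_left inner_add_right)
  then show ?thesis using vector_eq_ldot[of "S *v _" "T *v _"] by (metis matrix_eq)
qed

lemma inner_axis_matrix: "axis i 1 \<bullet> (S *v axis j 1) = S $ i $ j" for S :: "real^'n^'n"
  by (simp add: matrix_vector_mult_basis inner_axis' column_def)

text \<open>Polarisation: three values of the quadratic form fix an entry, so pointwise convergence
  of forms gives convergence of matrices.\<close>

lemma symmetric_matrix_entry:
  fixes S :: "real^'n^'n"
  assumes "transpose S = S"
  defines "q \<equiv> \<lambda>x. x \<bullet> (S *v x)"
  shows "S $ i $ j = (q (axis i 1 + axis j 1) - q (axis i 1) - q (axis j 1)) / 2"
  using inner_axis_matrix[of i S j] inner_symmetric_matrix[OF assms(1), of "axis i 1" "axis j 1"]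
    inner_commute[of "S *v axis i 1" "axis j 1"]
  unfolding q_def by (simp only: matrix_vector_right_distrib inner_add_left inner_add_right) simp

lemma symmetric_matrix_limit:
  fixes S :: "nat \<Rightarrow> real^'n^'n"
  assumes sym: "\<And>n. transpose (S n) = S n" and conv: "\<And>x. convergent (\<lambda>n. x \<bullet> (S n *v x))"
  obtains T where "transpose T = T" "S \<longlonglongrightarrow> T" "\<And>x. (\<lambda>n. x \<bullet> (S n *v x)) \<longlonglongrightarrow> x \<bullet> (T *v x)"
proof
  define T where "T = (\<chi> i j. lim (\<lambda>n. S n $ i $ j))"
  have "convergent (\<lambda>n. S n $ i $ j)" for i j
    unfolding symmetric_matrix_entry[OF sym, of _ i j] divide_inverse
    by (intro convergent_mult convergent_diff convergent_const conv)
  then have entry: "(\<lambda>n. S n $ i $ j) \<longlonglongrightarrow> T $ i $ j" for i j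
    by (simp add: T_def convergent_LIMSEQ_iff)
  have "S n $ j $ i = S n $ i $ j" for n i j
    by (subst sym[symmetric]) (simp add: transpose_def)
  then show "transpose T = T"
    by (simp add: T_def transpose_def vec_eq_iff)
  show "S \<longlonglongrightarrow> T" by (intro vec_tendstoI entry)
  show "(\<lambda>n. x \<bullet> (S n *v x)) \<longlonglongrightarrow> x \<bullet> (T *v x)" for x
    unfolding inner_vec_def matrix_vector_mult_def
    by (simp, intro tendsto_intros entry)
qed

lemma matrix_form_bound:
  fixes S :: "real^'n^'n"
  shows "\<bar>x \<bullet> (S *v x)\<bar> \<le> onorm ((*v) S) * (x \<bullet> x)"
proof -
  have "\<bar>x \<bullet> (S *v x)\<bar> \<le> norm x * norm (S *v x)" by (rule Cauchy_Schwarz_ineq2)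
  also have "\<dots> \<le> norm x * (onorm ((*v) S) * norm x)"
    by (intro mult_left_mono onorm matrix_vector_mul_bounded_linear) auto
  finally show ?thesis by (simp add: power2_norm_eq_inner[symmetric] power2_eq_square ac_simps)
qed

text \<open>The right-hand side of the equations without \<open>Q\<close>, acting on arbitrary
  functions. The cap \<open>min (Suc i) d\<close> merges the first \<open>d\<close> equations and
  the last one into a single shape.\<close>

definition lyap_form :: "nat \<Rightarrow> (nat \<Rightarrow> real^'n^'n) \<Rightarrow> (nat \<Rightarrow> real^'n^'n) \<Rightarrow>
    (nat \<Rightarrow> real^'n \<Rightarrow> real) \<Rightarrow> nat \<Rightarrow> real^'n \<Rightarrow> real" where
  "lyap_form d F G \<phi> i x = \<phi> (min (Suc i) d) (F i *v x) + \<phi> 0 (G i *v x)"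

definition lyap_matrix :: "nat \<Rightarrow> (nat \<Rightarrow> real^'n^'n) \<Rightarrow> (nat \<Rightarrow> real^'n^'n) \<Rightarrow>
    (nat \<Rightarrow> real^'n^'n) \<Rightarrow> nat \<Rightarrow> real^'n^'n" where
  "lyap_matrix d F G R i =
     transpose (F i) ** R (min (Suc i) d) ** F i + transpose (G i) ** R 0 ** G i"

definition form_of :: "(nat \<Rightarrow> real^'n^'n) \<Rightarrow> nat \<Rightarrow> real^'n \<Rightarrow> real" where
  "form_of R i x = x \<bullet> (R i *v x)"

definition form_le :: "nat \<Rightarrow> (nat \<Rightarrow> real^'n \<Rightarrow> real) \<Rightarrow> (nat \<Rightarrow> real^'n \<Rightarrow> real) \<Rightarrow> bool" where
  "form_le d \<phi> \<psi> \<longleftrightarrow> (\<forall>i\<le>d. \<forall>x. \<phi> i x \<le> \<psi> i x)"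

lemma form_le_trans: "form_le d \<phi> \<psi> \<Longrightarrow> form_le d \<psi> \<theta> \<Longrightarrow> form_le d \<phi> \<theta>"
  unfolding form_le_def by (blast intro: order_trans)

lemma inner_congruence:
  fixes S :: "real^'n^'n"
  shows "x \<bullet> ((transpose F ** S ** F) *v x) = (F *v x) \<bullet> (S *v (F *v x))"
proof -
  have "x \<bullet> (transpose F *v y) = (F *v x) \<bullet> y" for y
    by (metis dot_lmul_matrix vector_transpose_matrix transpose_transpose)
  then show ?thesis by (simp add: matrix_vector_mul_assoc[symmetric])
qed

lemma form_of_lyap_matrix: "form_of (lyap_matrix d F G R) = lyap_form d F G (form_of R)"
  by (intro ext)
    (simp add: form_of_def lyap_matrix_def lyap_form_def matrix_vector_mult_add_rdistrib
      inner_add_right inner_congruence)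

lemma form_of_add: "form_of (\<lambda>i. R i + S i) i x = form_of R i x + form_of S i x"
  by (simp add: form_of_def matrix_vector_mult_add_rdistrib inner_add_right)

lemma transpose_add: "transpose (S + T) = transpose S + transpose T" for S :: "real^'n^'m"
  by (simp add: transpose_def vec_eq_iff)

lemma symmetric_lyap_matrix:
  "(\<And>i. transpose (R i) = R i) \<Longrightarrow> transpose (lyap_matrix d F G R i) = lyap_matrix d F G R i"
  by (simp add: lyap_matrix_def transpose_add matrix_transpose_mul matrix_mul_assoc)

lemma lyap_form_mono: "form_le d \<phi> \<psi> \<Longrightarrow> form_le d (lyap_form d F G \<phi>) (lyap_form d F G \<psi>)"
  by (auto simp: form_le_def lyap_form_def intro!: add_mono)

lemma lyap_form_cmult: "lyap_form d F G (\<lambda>i x. c * \<phi> i x) i x = c * lyap_form d F G \<phi> i x"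
  by (simp add: lyap_form_def algebra_simps)

lemma lyap_form_funpow_mono:
  "form_le d \<phi> \<psi> \<Longrightarrow> form_le d ((lyap_form d F G ^^ t) \<phi>) ((lyap_form d F G ^^ t) \<psi>)"
  by (induction t) (auto intro: lyap_form_mono)

lemma lyap_form_funpow_cmult:
  "(lyap_form d F G ^^ t) (\<lambda>i x. c * \<phi> i x) = (\<lambda>i x. c * (lyap_form d F G ^^ t) \<phi> i x)"
  by (induction t) (auto simp: lyap_form_cmult)

lemma form_of_lyap_matrix_funpow:
  "form_of ((lyap_matrix d F G ^^ t) R) = (lyap_form d F G ^^ t) (form_of R)"
  by (induction t) (auto simp: form_of_lyap_matrix)

section \<open>Solving the Lyapunov equations when the iterates of the operator decay\<close>

locale lyapunov_stable =
  fixes d :: nat and F G :: "nat \<Rightarrow> real^'n^'n"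
  assumes decay: "i \<le> d \<Longrightarrow> (\<lambda>t. (lyap_form d F G ^^ t) (\<lambda>i x. x \<bullet> x) i x) \<longlonglongrightarrow> 0"
begin

abbreviation "\<Lambda> \<equiv> lyap_form d F G"
abbreviation "sq \<equiv> (\<lambda>(i::nat) (x::real^'n). x \<bullet> x)"

text \<open>Decay is assumed for each vector separately. Uniformity comes from finite dimension: the
  entries of the representing matrices tend to 0 by polarisation, they bound the operator norm, and
  there are finitely many ages.\<close>

lemma contraction:
  shows "\<exists>N. form_le d ((\<Lambda> ^^ N) sq) (\<lambda>i x. 1/2 * (x \<bullet> x))"
proof -
  define S where "S t = (lyap_matrix d F G ^^ t) (\<lambda>_. mat 1)" for t
  have S_form: "x \<bullet> (S t i *v x) = (\<Lambda> ^^ t) sq i x" for t i x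
    using fun_cong[OF fun_cong[OF form_of_lyap_matrix_funpow[where d = d and F = F and G = G and t = t and R = "\<lambda>_. mat 1"]], of i x]
    by (simp add: form_of_def[abs_def] S_def)
  have sym: "transpose (S t i) = S t i" for t i
    unfolding S_def by (induction t arbitrary: i) (auto intro: symmetric_lyap_matrix simp: transpose_mat)
  have "\<forall>\<^sub>F t in sequentially. \<forall>x. (\<Lambda> ^^ t) sq i x \<le> 1/2 * (x \<bullet> x)" if i: "i \<le> d" for i
  proof -
    let ?b = "\<lambda>t. \<Sum>a\<in>UNIV. \<Sum>b\<in>UNIV. \<bar>S t i $ a $ b\<bar>"
    have ent: "(\<lambda>t. S t i $ a $ b) \<longlonglongrightarrow> (0 - 0 - 0) / 2" for a b
      unfolding symmetric_matrix_entry[OF sym, of _ _ a b] S_form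
      by (intro tendsto_intros decay i) auto
    have "?b \<longlonglongrightarrow> (\<Sum>a\<in>(UNIV :: 'n set). \<Sum>b\<in>(UNIV :: 'n set). 0)"
      by (intro tendsto_sum tendsto_rabs_zero) (use ent in simp)
    then have "\<forall>\<^sub>F t in sequentially. ?b t < 1/2"
      by (rule order_tendstoD) auto
    then show ?thesis
    proof eventually_elim
      case (elim t)
      show ?case
      proof
        fix x
        have "x \<bullet> (S t i *v x) \<le> onorm ((*v) (S t i)) * (x \<bullet> x)"
          using matrix_form_bound[of x "S t i"] by linarith
        also have "\<dots> \<le> 1/2 * (x \<bullet> x)"
          using onorm_le_matrix_component_sum[of "S t i"] elim by (intro mult_right_mono) auto
        finally show "(\<Lambda> ^^ t) sq i x \<le> 1/2 * (x \<bullet> x)" by (simp add: S_form)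
      qed
    qed
  qed
  then have "\<forall>\<^sub>F t in sequentially. \<forall>i\<in>{..d}. \<forall>x. (\<Lambda> ^^ t) sq i x \<le> 1/2 * (x \<bullet> x)"
    by (intro eventually_ball_finite) auto
  then show ?thesis
    unfolding eventually_sequentially form_le_def by auto
qed

text \<open>A truncated Neumann series \<open>V\<close> is enough: telescoping leaves
  \<open>\<Lambda> V = V + (\<Lambda> ^^ N) sq - sq\<close>, which is at most
  \<open>V - 1/2 sq\<close>. Scaling by \<open>2 * c\<close> turns the gain of one half into
  \<open>c\<close>.\<close>

lemma supersolution:
  assumes "0 \<le> c"
  shows "\<exists>U. form_le d (\<lambda>i x. 0) U \<and> form_le d (\<lambda>i x. \<Lambda> U i x + c * (x \<bullet> x)) U"
proof -
  obtain N where N: "form_le d ((\<Lambda> ^^ N) sq) (\<lambda>i x. 1/2 * (x \<bullet> x))"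
    using contraction by blast
  define V where "V i x = (\<Sum>t<N. (\<Lambda> ^^ t) sq i x)" for i x
  \<comment> \<open>The zero form is written as \<open>0 * (x \<bullet> x)\<close> so that
    homogeneity evaluates its iterates.\<close>
  have pos: "0 \<le> (\<Lambda> ^^ t) sq i x" if "i \<le> d" for t i x
    using lyap_form_funpow_mono[where d = d and \<phi> = "\<lambda>i x. 0 * (x \<bullet> x)" and \<psi> = sq and F = F and G = G and t = t] that
    unfolding lyap_form_funpow_cmult by (simp add: form_le_def)
  have "\<Lambda> V i x = (\<Sum>t<N. (\<Lambda> ^^ Suc t) sq i x)" for i x
    by (simp add: V_def lyap_form_def sum.distrib)
  also have "\<dots> i x = V i x + (\<Lambda> ^^ N) sq i x - x \<bullet> x" for i x
    unfolding V_def using sum.lessThan_Suc_shift[of "\<lambda>t. (\<Lambda> ^^ t) sq i x" N] by simp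
  finally have V: "\<Lambda> V i x = V i x + (\<Lambda> ^^ N) sq i x - x \<bullet> x" for i x .
  have "\<Lambda> (\<lambda>i x. 2 * c * V i x) i x + c * (x \<bullet> x) \<le> 2 * c * V i x" if "i \<le> d" for i x
  proof -
    have "(\<Lambda> ^^ N) sq i x \<le> 1/2 * (x \<bullet> x)" using N that by (simp add: form_le_def)
    then have "2 * c * (\<Lambda> ^^ N) sq i x \<le> 2 * c * (1/2 * (x \<bullet> x))"
      using assms by (intro mult_left_mono) auto
    then show ?thesis unfolding lyap_form_cmult V by (simp add: algebra_simps)
  qed
  moreover have "0 \<le> 2 * c * V i x" if "i \<le> d" for i x
    unfolding V_def using assms by (simp add: zero_le_mult_iff sum_nonneg[OF pos[OF that]])
  ultimately show ?thesis
    unfolding form_le_def by (intro exI[of _ "\<lambda>i x. 2 * c * V i x"]) simp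
qed

text \<open>Monotone iteration from 0 increases since \<open>Q\<close> is semidefinite and stays
  below the supersolution, so it converges. The third conclusion is what later yields definiteness:
  \<open>P\<close> dominates every term of its own Neumann series.\<close>

lemma lyapunov_solution_exists:
  assumes Q: "pos_semidef Q"
  obtains P where "\<And>i. transpose (P i) = P i"
    "\<And>i. i \<le> d \<Longrightarrow> P i = lyap_matrix d F G P i + Q"
    "\<And>t. form_le d ((\<Lambda> ^^ t) (form_of (\<lambda>_. Q))) (form_of P)"
proof -
  have Q': "transpose Q = Q" "\<And>x. 0 \<le> x \<bullet> (Q *v x)" using Q by (auto simp: pos_semidef_def)
  let ?q = "form_of (\<lambda>_. Q)"
  \<comment> \<open>The value 0 beyond \<open>d\<close> makes the iteration converge at every index,
    so the limit is a total family of symmetric matrices.\<close>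
  define T where "T P i = (if i \<le> d then lyap_matrix d F G P i + Q else 0)" for P i
  define S where "S n = (T ^^ n) (\<lambda>_. 0)" for n
  have S0: "S 0 = (\<lambda>_. 0)" and S_Suc: "S (Suc n) = T (S n)" for n by (auto simp: S_def)
  have T_form: "form_of (T P) i x = \<Lambda> (form_of P) i x + ?q i x" if "i \<le> d" for P i x
    using that form_of_add[of "lyap_matrix d F G P" "\<lambda>_. Q" i x]
    by (simp add: form_of_def T_def flip: form_of_lyap_matrix)
  have T_mono: "form_le d (form_of P) (form_of P') \<Longrightarrow> form_le d (form_of (T P)) (form_of (T P'))" for P P'
    using lyap_form_mono[of d "form_of P" "form_of P'" F G] by (simp add: form_le_def T_form)
  define c where "c = onorm ((*v) Q)"
  have c: "0 \<le> c" unfolding c_def by (intro onorm_pos_le matrix_vector_mul_bounded_linear)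
  have qc: "x \<bullet> (Q *v x) \<le> c * (x \<bullet> x)" for x
    unfolding c_def using matrix_form_bound[of x Q] by linarith
  obtain U where U: "form_le d (\<lambda>i x. 0) U" "form_le d (\<lambda>i x. \<Lambda> U i x + c * (x \<bullet> x)) U"
    using supersolution[OF c] by blast
  have up: "form_le d (form_of (S n)) U" for n
  proof (induction n)
    case 0
    then show ?case using U(1) by (simp add: S0 form_of_def[abs_def] form_le_def)
  next
    case (Suc n)
    have "form_of (S (Suc n)) i x \<le> U i x" if i: "i \<le> d" for i x
    proof -
      have "form_of (S (Suc n)) i x = \<Lambda> (form_of (S n)) i x + ?q i x"
        by (simp add: S_Suc T_form i)
      also have "\<dots> \<le> \<Lambda> U i x + c * (x \<bullet> x)"
        using lyap_form_mono[OF Suc, of F G] i qc by (intro add_mono) (simp_all add: form_le_def form_of_def[of "\<lambda>_. Q"])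
      also have "\<dots> \<le> U i x" using U(2) i by (simp add: form_le_def)
      finally show ?thesis .
    qed
    then show ?case by (simp add: form_le_def)
  qed
  have inc: "form_le d (form_of (S n)) (form_of (S (Suc n)))" for n
  proof (induction n)
    case 0
    have "form_of (S (Suc 0)) i x = x \<bullet> (Q *v x)" if "i \<le> d" for i x
      by (simp add: S_Suc T_form that S0) (simp add: lyap_form_def form_of_def)
    then show ?case using Q'(2) by (simp add: form_le_def S0) (simp add: form_of_def)
  next
    case (Suc n)
    then show ?case using T_mono by (metis S_Suc)
  qed
  have sym: "transpose (S n i) = S n i" for n i
  proof (induction n arbitrary: i)
    case 0
    then show ?case by (simp add: S0 transpose_def vec_eq_iff)
  next
    case (Suc n)
    then show ?case
      by (auto simp: S_Suc T_def transpose_add symmetric_lyap_matrix Q'(1)) (simp add: transpose_def vec_eq_iff)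
  qed
  have conv: "convergent (\<lambda>n. x \<bullet> (S n i *v x))" for i x
  proof (cases "i \<le> d")
    case True
    have "incseq (\<lambda>n. x \<bullet> (S n i *v x))"
      using inc True by (auto intro: incseq_SucI simp: form_le_def form_of_def)
    moreover have "x \<bullet> (S n i *v x) \<le> U i x" for n
      using up True by (auto simp: form_le_def form_of_def)
    ultimately show ?thesis using incseq_convergent unfolding convergent_def by metis
  next
    case False
    then have "S n i = 0" for n by (cases n) (auto simp: S0 S_Suc T_def)
    then show ?thesis by (simp add: convergent_const)
  qed
  have "\<exists>T. transpose T = T \<and> (\<forall>x. (\<lambda>n. x \<bullet> (S n i *v x)) \<longlonglongrightarrow> x \<bullet> (T *v x))" for i
    by (rule symmetric_matrix_limit[where S = "\<lambda>n. S n i", OF sym conv]) blast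
  then have "\<exists>P. \<forall>i. transpose (P i) = P i \<and> (\<forall>x. (\<lambda>n. x \<bullet> (S n i *v x)) \<longlonglongrightarrow> x \<bullet> (P i *v x))"
    by (intro choice allI)
  then obtain P where P: "\<And>i. transpose (P i) = P i"
    "\<And>i x. (\<lambda>n. x \<bullet> (S n i *v x)) \<longlonglongrightarrow> x \<bullet> (P i *v x)"
    by blast
  have lim: "(\<lambda>n. form_of (S n) i x) \<longlonglongrightarrow> form_of P i x" for i x
    using P(2) by (simp add: form_of_def)
  have "P i = lyap_matrix d F G P i + Q" if i: "i \<le> d" for i
  proof (rule symmetric_matrix_eqI)
    fix x
    have "(\<lambda>n. form_of (S (Suc n)) i x) \<longlonglongrightarrow> \<Lambda> (form_of P) i x + ?q i x"
      unfolding S_Suc T_form[OF i] lyap_form_def by (intro tendsto_intros lim)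
    then have "form_of P i x = \<Lambda> (form_of P) i x + ?q i x"
      using LIMSEQ_unique LIMSEQ_Suc[OF lim] by blast
    then show "x \<bullet> (P i *v x) = x \<bullet> ((lyap_matrix d F G P i + Q) *v x)"
      using fun_cong[OF fun_cong[OF form_of_lyap_matrix[of d F G P]], of i x]
      by (simp add: form_of_def matrix_vector_mult_add_rdistrib inner_add_right)
  qed (simp_all add: P(1) transpose_add Q'(1) symmetric_lyap_matrix)
  moreover have "form_le d ((\<Lambda> ^^ t) ?q) (form_of P)" for t
  proof -
    have low: "form_le d (\<lambda>i x. 0) (\<lambda>i x. form_of (S n) i x)" for n
    proof (induction n)
      case (Suc n)
      then show ?case using inc[of n] form_le_trans by blast
    qed (simp add: form_le_def S0 form_of_def)
    \<comment> \<open>The iterate \<open>S (Suc t)\<close> is the partial sum of the Neumann series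
      up to exponent \<open>t\<close>; the shift by one is due to the start at 0.\<close>
    have "form_le d ((\<Lambda> ^^ t) ?q) (form_of (S (Suc t)))"
    proof (induction t)
      case 0
      then show ?case
        using lyap_form_mono[OF low[of 0], of F G] by (auto simp: form_le_def S_Suc T_form lyap_form_def)
    next
      case (Suc t)
      have "\<Lambda> ((\<Lambda> ^^ t) ?q) i x \<le> form_of (S (Suc (Suc t))) i x" if "i \<le> d" for i x
      proof -
        have "\<Lambda> ((\<Lambda> ^^ t) ?q) i x \<le> \<Lambda> (form_of (S (Suc t))) i x"
          using lyap_form_mono[OF Suc, of F G] that unfolding form_le_def by blast
        also have "\<dots> \<le> \<dots> + ?q i x"
          using Q'(2)[of x] by (simp add: form_of_def)
        also have "\<dots> = form_of (S (Suc (Suc t))) i x"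
          by (simp only: S_Suc[of "Suc t"] T_form[OF that])
        finally show ?thesis .
      qed
      then show ?case by (simp add: form_le_def)
    qed
    moreover have "form_of (S (Suc t)) i x \<le> form_of P i x" if "i \<le> d" for i x
      using lim inc that by (intro incseq_le) (auto intro: incseq_SucI simp: form_le_def)
    ultimately show ?thesis unfolding form_le_def by (meson order_trans)
  qed
  ultimately show thesis using that P(1) by blast
qed

text \<open>The difference \<open>D\<close> of the two forms is a fixed point of
  \<open>\<Lambda>\<close>. Once it is dominated by a multiple of \<open>sq\<close>, iterating keeps
  it below the same multiple of a sequence that tends to 0.\<close>

lemma lyapunov_solution_unique:
  assumes P: "\<And>i. i \<le> d \<Longrightarrow> transpose (P i) = P i" "\<And>i. i \<le> d \<Longrightarrow> P i = lyap_matrix d F G P i + Q"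
    and P': "\<And>i. i \<le> d \<Longrightarrow> transpose (P' i) = P' i" "\<And>i. i \<le> d \<Longrightarrow> P' i = lyap_matrix d F G P' i + Q"
    and i: "i \<le> d"
  shows "P i = P' i"
proof -
  define D where "D i x = form_of P i x - form_of P' i x" for i x
  have D: "D i x = \<Lambda> D i x" if "i \<le> d" for i x
  proof -
    have "form_of P i x = \<Lambda> (form_of P) i x + x \<bullet> (Q *v x)"
      unfolding form_of_lyap_matrix[symmetric]
      by (simp add: form_of_def) (subst P(2)[OF that], simp add: matrix_vector_mult_add_rdistrib inner_add_right)
    moreover have "form_of P' i x = \<Lambda> (form_of P') i x + x \<bullet> (Q *v x)"
      unfolding form_of_lyap_matrix[symmetric]
      by (simp add: form_of_def) (subst P'(2)[OF that], simp add: matrix_vector_mult_add_rdistrib inner_add_right)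
    ultimately show ?thesis by (simp add: D_def lyap_form_def)
  qed
  \<comment> \<open>Summing the norms gives one constant for all ages, as the induction mixes
    them.\<close>
  define c where "c = (\<Sum>i\<le>d. onorm ((*v) (P i - P' i)))"
  have bound: "\<bar>D i x\<bar> \<le> c * (x \<bullet> x)" if "i \<le> d" for i x
  proof -
    have "\<bar>D i x\<bar> \<le> onorm ((*v) (P i - P' i)) * (x \<bullet> x)"
      using matrix_form_bound[of x "P i - P' i"]
      by (simp add: D_def form_of_def matrix_vector_mult_diff_rdistrib inner_diff_right)
    also have "\<dots> \<le> c * (x \<bullet> x)"
      unfolding c_def using that
      by (intro mult_right_mono member_le_sum onorm_pos_le matrix_vector_mul_bounded_linear) auto
    finally show ?thesis .
  qed
  have iter: "\<bar>D i x\<bar> \<le> c * (\<Lambda> ^^ t) sq i x" if "i \<le> d" for t i x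
    using that
  proof (induction t arbitrary: i x)
    case 0
    then show ?case using bound by simp
  next
    case (Suc t)
    have "\<bar>D i x\<bar> = \<bar>\<Lambda> D i x\<bar>" using D[OF Suc.prems] by metis
    also have "\<dots> \<le> \<bar>D (min (Suc i) d) (F i *v x)\<bar> + \<bar>D 0 (G i *v x)\<bar>"
      unfolding lyap_form_def by (rule abs_triangle_ineq)
    also have "\<dots> \<le> c * (\<Lambda> ^^ t) sq (min (Suc i) d) (F i *v x) + c * (\<Lambda> ^^ t) sq 0 (G i *v x)"
      by (intro add_mono Suc.IH) auto
    also have "\<dots> = c * (\<Lambda> ^^ Suc t) sq i x" by (simp add: lyap_form_def algebra_simps)
    finally show ?case .
  qed
  have "D i x = 0" for x
  proof -
    have "(\<lambda>t. c * (\<Lambda> ^^ t) sq i x) \<longlonglongrightarrow> c * 0" by (intro tendsto_intros decay i)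
    from LIMSEQ_le_const[OF this, of "\<bar>D i x\<bar>"] iter[OF i] show ?thesis by auto
  qed
  then have "x \<bullet> (P i *v x) = x \<bullet> (P' i *v x)" for x
    by (simp add: D_def form_of_def)
  then show ?thesis by (rule symmetric_matrix_eqI[OF P(1)[OF i] P'(1)[OF i]])
qed

end

lemma lyapunov_equations_iff:
  "lyapunov_equations d A Abar B Bbar K Q P \<longleftrightarrow>
    (\<forall>i\<le>d. P i = lyap_matrix d (mode d A B K) (mode d Abar Bbar K) P i + Q)"
  (is "?L \<longleftrightarrow> ?R")
proof -
  have "(\<forall>i\<in>{1..d}. P (i - 1) = transpose A ** P i ** A + transpose Abar ** P 0 ** Abar + Q) \<longleftrightarrow>
      (\<forall>i<d. P i = lyap_matrix d (mode d A B K) (mode d Abar Bbar K) P i + Q)" (is "?L1 \<longleftrightarrow> ?R1")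
  proof
    assume L: ?L1
    show ?R1
    proof (intro allI impI)
      fix i assume "i < d"
      then show "P i = lyap_matrix d (mode d A B K) (mode d Abar Bbar K) P i + Q"
        using bspec[OF L, of "Suc i"] by (simp add: lyap_matrix_def mode_def Suc_leI)
    qed
  next
    assume R: ?R1
    show ?L1
    proof
      fix i assume "i \<in> {1..d}"
      then show "P (i - 1) = transpose A ** P i ** A + transpose Abar ** P 0 ** Abar + Q"
        using R[rule_format, of "i - 1"] by (cases i) (simp_all add: lyap_matrix_def mode_def)
    qed
  qed
  moreover have "(\<forall>i\<le>d. X i) \<longleftrightarrow> (\<forall>i<d. X i) \<and> X d" for X
    by (metis le_neq_implies_less le_refl less_imp_le)
  ultimately show ?thesis
    by (simp add: lyapunov_equations_def lyap_matrix_def mode_def)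
qed

section \<open>Chaos expansion in the noise\<close>

locale white_noise_space = prob_space M for M :: "'a measure" +
  fixes w :: "nat \<Rightarrow> 'a \<Rightarrow> real"
  assumes indep: "indep_vars (\<lambda>_. borel) w UNIV"
    and square_integrable: "integrable M (\<lambda>\<omega>. (w k \<omega>)\<^sup>2)"
    and mean: "(\<integral>\<omega>. w k \<omega> \<partial>M) = 0"
    and variance: "(\<integral>\<omega>. (w k \<omega>)\<^sup>2 \<partial>M) = 1"
begin

definition chaos :: "nat set \<Rightarrow> 'a \<Rightarrow> real" where
  "chaos S \<omega> = (\<Prod>s\<in>S. w s \<omega>)"

abbreviation "\<F> \<equiv> noise_filtration M w"

lemma measurable_noise [measurable]: "w k \<in> borel_measurable M"
  using indep unfolding indep_vars_def by auto

lemma integrable_noise: "integrable M (w k)"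
  using square_integrable_imp_integrable[OF _ square_integrable] by simp

lemma measurable_chaos [measurable]: "chaos S \<in> borel_measurable M"
  unfolding chaos_def by measurable

text \<open>Independence factors the expectation: an index in both sets contributes the variance 1,
  an index in only one of them the mean 0.\<close>

lemma chaos_product:
  assumes "finite S" "finite T"
  shows integrable_chaos_product: "integrable M (\<lambda>\<omega>. chaos S \<omega> * chaos T \<omega>)"
    and integral_chaos_product: "(\<integral>\<omega>. chaos S \<omega> * chaos T \<omega> \<partial>M) = (if S = T then 1 else 0)"
proof -
  define h where "h s = (\<lambda>r::real. if s \<in> S \<inter> T then r\<^sup>2 else r)" for s
  define X where "X s \<omega> = h s (w s \<omega>)" for s \<omega>
  have eq: "chaos S \<omega> * chaos T \<omega> = (\<Prod>s\<in>S \<union> T. X s \<omega>)" for \<omega>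
  proof -
    have "(\<Prod>s\<in>S \<union> T. X s \<omega>) =
        (\<Prod>s\<in>S \<union> T. (if s \<in> S then w s \<omega> else 1) * (if s \<in> T then w s \<omega> else 1))"
      by (intro prod.cong) (auto simp: X_def h_def power2_eq_square)
    also have "\<dots> = (\<Prod>s\<in>S \<union> T. if s \<in> S then w s \<omega> else 1) * (\<Prod>s\<in>S \<union> T. if s \<in> T then w s \<omega> else 1)"
      by (rule prod.distrib)
    also have "(\<Prod>s\<in>S \<union> T. if s \<in> S then w s \<omega> else 1) = (\<Prod>s\<in>S. w s \<omega>)"
      using assms by (intro prod.mono_neutral_cong_right) auto
    also have "(\<Prod>s\<in>S \<union> T. if s \<in> T then w s \<omega> else 1) = (\<Prod>s\<in>T. w s \<omega>)"
      using assms by (intro prod.mono_neutral_cong_right) auto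
    finally show ?thesis by (simp add: chaos_def)
  qed
  have "indep_vars (\<lambda>_. borel) w (S \<union> T)"
    using indep indep_vars_subset by blast
  then have ind: "indep_vars (\<lambda>_. borel) X (S \<union> T)"
    unfolding X_def[abs_def] by (rule indep_vars_compose2) (auto simp: h_def)
  have int: "integrable M (X s)" for s
    using integrable_noise square_integrable by (cases "s \<in> S \<inter> T") (simp_all only: X_def[abs_def] h_def if_True if_False)
  show "integrable M (\<lambda>\<omega>. chaos S \<omega> * chaos T \<omega>)"
    unfolding eq using assms ind int by (intro indep_vars_integrable) auto
  have "(\<integral>\<omega>. chaos S \<omega> * chaos T \<omega> \<partial>M) = (\<Prod>s\<in>S \<union> T. \<integral>\<omega>. X s \<omega> \<partial>M)"
    unfolding eq using assms ind int by (intro indep_vars_lebesgue_integral) auto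
  also have "\<dots> = (\<Prod>s\<in>S \<union> T. if s \<in> S \<inter> T then 1 else 0)"
    by (intro prod.cong) (auto simp: X_def h_def mean variance)
  also have "\<dots> = (if S = T then 1 else 0)"
    using assms by (auto simp: prod_zero_iff)
  finally show "(\<integral>\<omega>. chaos S \<omega> * chaos T \<omega> \<partial>M) = (if S = T then 1 else 0)" .
qed

lemma integrable_chaos: "finite S \<Longrightarrow> integrable M (chaos S)"
  using integrable_chaos_product[of S "{}"] by (simp add: chaos_def[abs_def])

lemma space_filtration [simp]: "space (\<F> m) = space M"
  by (simp add: noise_filtration_def space_measure_of_conv)

lemma subalgebra_filtration: "subalgebra M (\<F> m)"
  unfolding subalgebra_def space_filtration unfolding noise_filtration_def
  by (subst sets_measure_of) (auto intro!: sets.sigma_sets_subset)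

lemma measurable_noise_filtration:
  assumes "int s \<le> m"
  shows "w s \<in> borel_measurable (\<F> m)"
proof (rule measurableI)
  fix A :: "real set" assume "A \<in> sets borel"
  then show "w s -` A \<inter> space (\<F> m) \<in> sets (\<F> m)"
    unfolding space_filtration using assms unfolding noise_filtration_def
    by (subst sets_measure_of) (auto intro!: sigma_sets.Basic)
qed simp

lemma measurable_chaos_filtration:
  "(\<And>s. s \<in> S \<Longrightarrow> int s \<le> m) \<Longrightarrow> chaos S \<in> borel_measurable (\<F> m)"
  unfolding chaos_def by (intro borel_measurable_prod measurable_noise_filtration)

lemma sigma_finite_subalgebra_filtration: "sigma_finite_subalgebra M (\<F> m)"
proof -
  interpret finite_measure_subalgebra M "\<F> m"
    by unfold_locales (rule subalgebra_filtration)
  show ?thesis by (rule sigma_finite_subalgebra_axioms)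
qed

text \<open>The factor with the largest index is independent of the remaining factors and of the event,
  and has mean zero.\<close>

lemma integral_chaos_filtration_event:
  assumes S: "finite S" "s \<in> S" "m < int s" and A: "A \<in> sets (\<F> m)"
  shows "(\<integral>\<omega>. indicator A \<omega> * chaos S \<omega> \<partial>M) = 0"
proof -
  define t where "t = Max S"
  have t: "t \<in> S" "\<And>r. r \<in> S \<Longrightarrow> r \<le> t" "m < int t"
  proof -
    show "t \<in> S" using S Max_in unfolding t_def by blast
    show le: "r \<le> t" if "r \<in> S" for r using S(1) that by (simp add: t_def)
    show "m < int t" using le[OF S(2)] S(3) by simp
  qed
  let ?V = "\<lambda>\<omega>. restrict (\<lambda>i. w i \<omega>) {..<t}"
  let ?N = "PiM {..<t} (\<lambda>_. borel :: real measure)"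
  have V: "?V \<in> space M \<rightarrow> space ?N"
    by (auto simp: space_PiM)
  \<comment> \<open>Events of the filtration are determined by the noise before \<open>t\<close>,
    hence are preimages under the truncated noise vector \<open>?V\<close>; this is the form to
    which independence of \<open>w t\<close> applies.\<close>
  have "sets (\<F> m) \<subseteq> sets (vimage_algebra (space M) ?V ?N)"
    unfolding noise_filtration_def
  proof (subst sets_measure_of, force, intro sets.sigma_sets_subset[of _ "vimage_algebra (space M) ?V ?N", simplified] subsetI)
    fix B assume "B \<in> {w s -` S \<inter> space M |s S. int s \<le> m \<and> S \<in> sets borel}"
    then obtain r C where B: "B = w r -` C \<inter> space M" "int r \<le> m" "C \<in> sets borel" by blast
    then have "r < t" using t(3) by simp
    then have "(\<lambda>f. f r) -` C \<inter> space ?N \<in> sets ?N"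
      using B(3) by (intro measurable_sets[OF measurable_component_singleton]) auto
    moreover have "B = ?V -` ((\<lambda>f. f r) -` C \<inter> space ?N) \<inter> space M"
      using B(1) \<open>r < t\<close> V by auto
    ultimately show "B \<in> sets (vimage_algebra (space M) ?V ?N)"
      by (metis in_vimage_algebra)
  qed
  then obtain B where B: "B \<in> sets ?N" "A = ?V -` B \<inter> space M"
    using A unfolding sets_vimage_algebra2[OF V] by blast
  let ?f = "\<lambda>v. indicator B v * (\<Prod>r\<in>S - {t}. v r) :: real"
  have sub: "r < t" if "r \<in> S - {t}" for r
    using t(2)[of r] that by auto
  have "indep_var ?N ?V (PiM {t} (\<lambda>_. borel)) (\<lambda>\<omega>. restrict (\<lambda>i. w i \<omega>) {t})"
    using indep by (intro indep_var_restrict[where I = UNIV]) auto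
  moreover have f: "?f \<in> borel_measurable ?N"
    using B(1) sub by (intro borel_measurable_times borel_measurable_indicator borel_measurable_prod
      measurable_component_singleton) auto
  moreover have "(\<lambda>v. v t) \<in> borel_measurable (PiM {t} (\<lambda>_. borel :: real measure))"
    by (intro measurable_component_singleton) auto
  ultimately have ind: "indep_var borel (?f \<circ> ?V) borel ((\<lambda>v. v t) \<circ> (\<lambda>\<omega>. restrict (\<lambda>i. w i \<omega>) {t}))"
    by (rule indep_var_compose)
  have fV: "?f (?V \<omega>) = indicator A \<omega> * chaos (S - {t}) \<omega>" if "\<omega> \<in> space M" for \<omega>
    using that sub unfolding chaos_def B(2) by (auto simp: indicator_def intro!: prod.cong)
  have int: "integrable M (\<lambda>\<omega>. indicator A \<omega> * chaos (S - {t}) \<omega>)"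
    using integrable_real_mult_indicator[of A M "chaos (S - {t})"] integrable_chaos[of "S - {t}"]
      A subalgebra_filtration[of m] S(1) by (auto simp: subalgebra_def mult.commute)
  then have int': "integrable M (?f \<circ> ?V)"
    by (subst Bochner_Integration.integrable_cong[OF refl, where g = "\<lambda>\<omega>. indicator A \<omega> * chaos (S - {t}) \<omega>"]) (auto simp only: fV o_def)
  have "(\<integral>\<omega>. indicator A \<omega> * chaos S \<omega> \<partial>M) = (\<integral>\<omega>. (?f \<circ> ?V) \<omega> * w t \<omega> \<partial>M)"
  proof (rule Bochner_Integration.integral_cong)
    fix \<omega> assume "\<omega> \<in> space M"
    moreover have "chaos S \<omega> = chaos (S - {t}) \<omega> * w t \<omega>"
      unfolding chaos_def using S(1) t(1) by (simp add: prod.remove[of S t])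
    ultimately show "indicator A \<omega> * chaos S \<omega> = (?f \<circ> ?V) \<omega> * w t \<omega>"
      using fV[of \<omega>] by simp
  qed simp
  also have "\<dots> = (\<integral>\<omega>. (?f \<circ> ?V) \<omega> \<partial>M) * (\<integral>\<omega>. w t \<omega> \<partial>M)"
    using indep_var_lebesgue_integral[OF ind int'] integrable_noise by (simp add: o_def)
  finally show ?thesis by (simp add: mean)
qed

lemma cond_exp_chaos:
  assumes "finite S"
  shows "AE \<omega> in M. real_cond_exp M (\<F> m) (chaos S) \<omega> = (if \<forall>s\<in>S. int s \<le> m then chaos S \<omega> else 0)"
proof -
  interpret sigma_finite_subalgebra M "\<F> m" by (rule sigma_finite_subalgebra_filtration)
  show ?thesis
  proof (cases "\<forall>s\<in>S. int s \<le> m")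
    case True
    then show ?thesis
      using real_cond_exp_F_meas[OF integrable_chaos[OF assms] measurable_chaos_filtration[of S m]] by simp
  next
    case False
    then obtain s where s: "s \<in> S" "m < int s" by (auto simp: not_le)
    have "AE \<omega> in M. real_cond_exp M (\<F> m) (chaos S) \<omega> = 0"
      using integral_chaos_filtration_event[OF assms s] integrable_chaos[OF assms]
      by (intro real_cond_exp_charact) (auto simp: set_lebesgue_integral_def)
    with False show ?thesis by (simp only: if_False)
  qed
qed

definition chaos_sum :: "nat set set \<Rightarrow> (nat set \<Rightarrow> real^'k) \<Rightarrow> 'a \<Rightarrow> real^'k" where
  "chaos_sum \<S> c \<omega> = (\<Sum>S\<in>\<S>. chaos S \<omega> *\<^sub>R c S)"

lemma measurable_chaos_sum [measurable]: "chaos_sum \<S> c \<in> borel_measurable M"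
  unfolding chaos_sum_def[abs_def] by measurable

lemma cond_exp_chaos_sum:
  fixes c :: "nat set \<Rightarrow> real^'k"
  assumes X: "X \<in> borel_measurable M" "AE \<omega> in M. X \<omega> = chaos_sum \<S> c \<omega>"
    and fin: "\<And>S. S \<in> \<S> \<Longrightarrow> finite S"
  shows "AE \<omega> in M. vec_cond_exp M (\<F> m) X \<omega> =
    chaos_sum \<S> (\<lambda>S. if \<forall>s\<in>S. int s \<le> m then c S else 0) \<omega>"
proof -
  interpret sigma_finite_subalgebra M "\<F> m" by (rule sigma_finite_subalgebra_filtration)
  let ?r = "real_cond_exp M (\<F> m)"
  have "AE \<omega> in M. ?r (\<lambda>\<omega>. X \<omega> $ i) \<omega> =
      chaos_sum \<S> (\<lambda>S. if \<forall>s\<in>S. int s \<le> m then c S else 0) \<omega> $ i" for i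
  proof -
    \<comment> \<open>Outside the index family the term is zero, since linearity of the conditional
      expectation is invoked with integrability at every index.\<close>
    define g where "g S \<omega> = (if S \<in> \<S> then c S $ i * chaos S \<omega> else 0)" for S \<omega>
    have int: "integrable M (g S)" for S
      using integrable_chaos[OF fin, of S] by (cases "S \<in> \<S>") (simp_all add: g_def[abs_def])
    have comp: "chaos_sum \<S> c \<omega> $ i = (\<Sum>S\<in>\<S>. g S \<omega>)" for \<omega>
      by (auto simp: chaos_sum_def g_def sum_component intro!: sum.cong)
    have m: "(\<lambda>\<omega>. X \<omega> $ i) \<in> borel_measurable M" "(\<lambda>\<omega>. \<Sum>S\<in>\<S>. g S \<omega>) \<in> borel_measurable M"
      using borel_measurable_inner[OF X(1) borel_measurable_const[of "axis i 1"]] int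
      by (auto simp: inner_axis intro: borel_measurable_integrable)
    have 1: "AE \<omega> in M. ?r (\<lambda>\<omega>. X \<omega> $ i) \<omega> = ?r (\<lambda>\<omega>. \<Sum>S\<in>\<S>. g S \<omega>) \<omega>"
      using X(2) by (intro real_cond_exp_cong m) (auto simp flip: comp)
    have 2: "AE \<omega> in M. ?r (\<lambda>\<omega>. \<Sum>S\<in>\<S>. g S \<omega>) \<omega> = (\<Sum>S\<in>\<S>. ?r (g S) \<omega>)"
      by (rule real_cond_exp_sum[OF int])
    have 3: "AE \<omega> in M. ?r (g S) \<omega> = (if \<forall>s\<in>S. int s \<le> m then g S \<omega> else 0)" if "S \<in> \<S>" for S
    proof -
      have "AE \<omega> in M. ?r (\<lambda>\<omega>. c S $ i * chaos S \<omega>) \<omega> = c S $ i * ?r (chaos S) \<omega>"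
        using integrable_chaos[OF fin[OF that]] by (rule real_cond_exp_cmult)
      with cond_exp_chaos[OF fin[OF that], of m] show ?thesis
        by eventually_elim (use that in \<open>simp add: g_def[abs_def]\<close>)
    qed
    show ?thesis
    proof (cases "finite \<S>")
      case True
      then have "AE \<omega> in M. \<forall>S\<in>\<S>. ?r (g S) \<omega> = (if \<forall>s\<in>S. int s \<le> m then g S \<omega> else 0)"
        using 3 by (intro AE_finite_allI) auto
      with 1 2 show ?thesis
      proof eventually_elim
        case (elim \<omega>)
        have "chaos_sum \<S> (\<lambda>S. if \<forall>s\<in>S. int s \<le> m then c S else 0) \<omega> $ i =
            (\<Sum>S\<in>\<S>. if \<forall>s\<in>S. int s \<le> m then g S \<omega> else 0)"
          by (auto simp: chaos_sum_def sum_component g_def intro!: sum.cong)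
        also have "\<dots> = (\<Sum>S\<in>\<S>. ?r (g S) \<omega>)"
          using elim(3) by (intro sum.cong) auto
        finally show ?case using elim by simp
      qed
    next
      case False
      from 1 2 show ?thesis by eventually_elim (use False in \<open>simp add: chaos_sum_def\<close>)
    qed
  qed
  then have "AE \<omega> in M. \<forall>i. ?r (\<lambda>\<omega>. X \<omega> $ i) \<omega> =
      chaos_sum \<S> (\<lambda>S. if \<forall>s\<in>S. int s \<le> m then c S else 0) \<omega> $ i"
    by (simp add: AE_all_countable)
  then show ?thesis
    by eventually_elim (simp add: vec_cond_exp_def vec_eq_iff)
qed

text \<open>Parseval's identity for the orthonormal family \<open>chaos\<close>.\<close>

lemma second_moment_chaos_sum:
  assumes fin: "finite \<S>" "\<And>S. S \<in> \<S> \<Longrightarrow> finite S"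
  shows "(\<integral>\<omega>. chaos_sum \<S> c \<omega> \<bullet> chaos_sum \<S> c \<omega> \<partial>M) = (\<Sum>S\<in>\<S>. c S \<bullet> c S)"
proof -
  have expand: "chaos_sum \<S> c \<omega> \<bullet> chaos_sum \<S> c \<omega> =
      (\<Sum>S\<in>\<S>. \<Sum>T\<in>\<S>. (chaos S \<omega> * chaos T \<omega>) * (c S \<bullet> c T))" for \<omega>
    unfolding chaos_sum_def inner_sum_left unfolding inner_sum_right by (simp add: ac_simps)
  have "(\<integral>\<omega>. chaos_sum \<S> c \<omega> \<bullet> chaos_sum \<S> c \<omega> \<partial>M) =
      (\<Sum>S\<in>\<S>. \<Sum>T\<in>\<S>. (\<integral>\<omega>. chaos S \<omega> * chaos T \<omega> \<partial>M) * (c S \<bullet> c T))"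
    unfolding expand using integrable_chaos_product fin
    by (subst Bochner_Integration.integral_sum; simp)+
  also have "\<dots> = (\<Sum>S\<in>\<S>. \<Sum>T\<in>\<S>. if S = T then c S \<bullet> c T else 0)"
    using fin by (intro sum.cong) (auto simp: integral_chaos_product)
  also have "\<dots> = (\<Sum>S\<in>\<S>. c S \<bullet> c S)"
    using fin(1) by simp
  finally show ?thesis .
qed

end

lemma white_noise_spaceI: "white_noise M w \<Longrightarrow> white_noise_space M w"
  unfolding white_noise_def white_noise_space_def white_noise_space_axioms_def
  by (auto simp: power2_eq_square)

section \<open>The delayed closed loop\<close>

text \<open>The age of the chaos component indexed by \<^term>\<open>S\<close> at time \<^term>\<open>k\<close> tells how long ago its last
  noise variable entered, cut off at the delay \<^term>\<open>d\<close>, from which on the component is visible to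
  the controller.  The empty set carries the mean state, whose age is \<^term>\<open>start\<close> at time 0.\<close>

definition age :: "nat \<Rightarrow> nat \<Rightarrow> nat \<Rightarrow> nat set \<Rightarrow> nat" where
  "age d start k S = (if S = {} then min (start + k) d else min (k - 1 - Max S) d)"

lemma age_le: "age d start k S \<le> d"
  by (simp add: age_def)

lemma age_Suc: "S \<subseteq> {..<k} \<Longrightarrow> age d start (Suc k) S = min (Suc (age d start k S)) d"
proof (cases "S = {}")
  case False
  assume S: "S \<subseteq> {..<k}"
  then have "Max S < k"
    using False Max_in[of S] finite_subset[OF S] by auto
  then show ?thesis using False by (auto simp: age_def)
qed (auto simp: age_def)

lemma age_insert: "S \<subseteq> {..<k} \<Longrightarrow> age d start (Suc k) (insert k S) = 0"
proof -
  assume S: "S \<subseteq> {..<k}"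
  then have "Max (insert k S) = k"
    using finite_subset[OF S] by (intro Max_eqI) auto
  then show ?thesis by (simp add: age_def)
qed

text \<open>Links age to information: age \<open>d\<close> means exactly that the component is
  measurable for the filtration used by the controller at time \<open>k\<close>. For the empty set
  both sides hold because \<open>d \<le> k\<close>.\<close>

lemma age_eq_delay_iff:
  assumes "S \<subseteq> {..<k}" "d \<le> k"
  shows "age d start k S = d \<longleftrightarrow> (\<forall>s\<in>S. int s \<le> int k - int d - 1)"
proof (cases "S = {}")
  case False
  have fin: "finite S" using assms finite_subset by blast
  have "Max S < k" using assms(1) Max_in[OF fin False] by auto
  then have "age d start k S = d \<longleftrightarrow> int (Max S) \<le> int k - int d - 1"
    using False by (auto simp: age_def)
  also have "\<dots> \<longleftrightarrow> (\<forall>s\<in>S. int s \<le> int k - int d - 1)"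
    using Max_in[OF fin False] Max_ge[OF fin] by force
  finally show ?thesis .
qed (use assms in \<open>auto simp: age_def\<close>)

lemma age_less_delay: "S \<noteq> {} \<Longrightarrow> k < d \<Longrightarrow> age d start k S < d"
  by (simp add: age_def)

lemma sum_Pow_lessThan_Suc:
  fixes h :: "nat set \<Rightarrow> 'b::comm_monoid_add"
  shows "(\<Sum>S\<in>Pow {..<Suc k}. h S) = (\<Sum>S\<in>Pow {..<k}. h S + h (insert k S))"
proof -
  have "(\<Sum>S\<in>Pow {..<Suc k}. h S) = (\<Sum>S\<in>Pow {..<k} \<union> insert k ` Pow {..<k}. h S)"
    by (simp add: lessThan_Suc Pow_insert)
  also have "\<dots> = (\<Sum>S\<in>Pow {..<k}. h S) + (\<Sum>S\<in>insert k ` Pow {..<k}. h S)"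
    by (intro sum.union_disjoint) auto
  also have "(\<Sum>S\<in>insert k ` Pow {..<k}. h S) = (\<Sum>S\<in>Pow {..<k}. h (insert k S))"
  proof (subst sum.reindex)
    show "inj_on (insert k) (Pow {..<k})"
    proof (rule inj_onI)
      fix S T assume "S \<in> Pow {..<k}" "T \<in> Pow {..<k}" "insert k S = insert k T"
      moreover have "k \<notin> S" "k \<notin> T" using calculation by auto
      ultimately show "S = T" by (metis insert_ident)
    qed
  qed simp
  finally show ?thesis by (simp add: sum.distrib)
qed

section \<open>Evolution of the chaos coefficients and its duality with the operator\<close>

definition chaos_step :: "nat \<Rightarrow> (nat \<Rightarrow> real^'n^'n) \<Rightarrow> (nat \<Rightarrow> real^'n^'n) \<Rightarrow> nat \<Rightarrow> nat \<Rightarrow>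
    (nat set \<Rightarrow> real^'n) \<Rightarrow> nat set \<Rightarrow> real^'n" where
  "chaos_step d F G start k c S =
     (if k \<in> S then G (age d start k (S - {k})) *v c (S - {k}) else F (age d start k S) *v c S)"

primrec chaos_coeff :: "nat \<Rightarrow> (nat \<Rightarrow> real^'n^'n) \<Rightarrow> (nat \<Rightarrow> real^'n^'n) \<Rightarrow> nat \<Rightarrow> nat \<Rightarrow>
    (nat set \<Rightarrow> real^'n) \<Rightarrow> nat \<Rightarrow> nat set \<Rightarrow> real^'n" where
  "chaos_coeff d F G start j c 0 = c"
| "chaos_coeff d F G start j c (Suc t) = chaos_step d F G start (j + t) (chaos_coeff d F G start j c t)"

text \<open>For an age-independent quadratic form this is the expected value of that form at the
  state; dependence on age is what lets the operator act.\<close>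

definition energy :: "nat \<Rightarrow> (nat \<Rightarrow> real^'n \<Rightarrow> real) \<Rightarrow> nat \<Rightarrow> nat \<Rightarrow> (nat set \<Rightarrow> real^'n) \<Rightarrow> real" where
  "energy d \<phi> start k c = (\<Sum>S\<in>Pow {..<k}. \<phi> (age d start k S) (c S))"

lemma chaos_step_old: "S \<subseteq> {..<k} \<Longrightarrow> chaos_step d F G start k c S = F (age d start k S) *v c S"
  by (auto simp: chaos_step_def)

lemma chaos_step_new: "S \<subseteq> {..<k} \<Longrightarrow> chaos_step d F G start k c (insert k S) = G (age d start k S) *v c S"
proof -
  assume "S \<subseteq> {..<k}"
  then have "insert k S - {k} = S" by auto
  then show ?thesis by (simp add: chaos_step_def)
qed

text \<open>Pushing the coefficients one step forward is dual to pulling the form one step back: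
  each set \<open>S\<close> has the two successors \<open>S\<close> and \<open>insert k S\<close>,
  which give the two summands of \<open>lyap_form\<close>.\<close>

lemma energy_chaos_step:
  "energy d \<phi> start (Suc k) (chaos_step d F G start k c) = energy d (lyap_form d F G \<phi>) start k c"
  unfolding energy_def sum_Pow_lessThan_Suc lyap_form_def
  by (intro sum.cong) (simp_all add: chaos_step_old chaos_step_new age_Suc age_insert)

lemma energy_chaos_coeff:
  "energy d \<phi> start (j + t) (chaos_coeff d F G start j c t) = energy d ((lyap_form d F G ^^ t) \<phi>) start j c"
proof (induction t arbitrary: \<phi>)
  case (Suc t)
  then show ?case
    by (simp only: add_Suc_right chaos_coeff.simps energy_chaos_step funpow_Suc_right o_apply)
qed simp

lemma lyap_form_funpow_zero:
  "(\<And>i. \<phi> i 0 = 0) \<Longrightarrow> (lyap_form d F G ^^ t) \<phi> i 0 = 0"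
  by (induction t arbitrary: i) (auto simp: lyap_form_def)

lemma energy_single:
  assumes "\<And>i. \<phi> i 0 = 0" "S \<subseteq> {..<k}"
  shows "energy d \<phi> start k (\<lambda>T. if T = S then x else 0) = \<phi> (age d start k S) x"
proof -
  have "energy d \<phi> start k (\<lambda>T. if T = S then x else 0) =
      (\<Sum>T\<in>Pow {..<k}. if T = S then \<phi> (age d start k S) x else 0)"
    unfolding energy_def using assms(1) by (intro sum.cong) auto
  then show ?thesis using assms(2) by simp
qed

context white_noise_space
begin

lemma chaos_insert: "S \<subseteq> {..<k} \<Longrightarrow> chaos (insert k S) \<omega> = w k \<omega> * chaos S \<omega>"
  unfolding chaos_def by (subst prod.insert) (auto intro: finite_subset)

lemma chaos_sum_step:
  "chaos_sum (Pow {..<Suc k}) (chaos_step d F G start k c) \<omega> =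
     chaos_sum (Pow {..<k}) (\<lambda>S. F (age d start k S) *v c S) \<omega> +
     w k \<omega> *\<^sub>R chaos_sum (Pow {..<k}) (\<lambda>S. G (age d start k S) *v c S) \<omega>"
  unfolding chaos_sum_def sum_Pow_lessThan_Suc scaleR_sum_right sum.distrib[symmetric]
  by (intro sum.cong) (simp_all add: chaos_step_old chaos_step_new chaos_insert)

lemma matrix_chaos_sum: "R *v chaos_sum \<S> c \<omega> = chaos_sum \<S> (\<lambda>S. R *v c S) \<omega>"
  by (simp add: chaos_sum_def linear_sum[OF matrix_vector_mul_linear] matrix_vector_mult_scaleR)

lemma chaos_sum_add: "chaos_sum \<S> c \<omega> + chaos_sum \<S> c' \<omega> = chaos_sum \<S> (\<lambda>S. c S + c' S) \<omega>"
  by (simp add: chaos_sum_def sum.distrib scaleR_add_right)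

text \<open>An input that feeds back exactly the components of age \<open>d\<close> turns the plant
  matrices into \<open>mode\<close>. The statement is for a single outcome, so that almost-sure
  equalities can be inserted afterwards.\<close>

lemma plant_step_chaos_sum:
  fixes A Abar :: "real^'n^'n" and B Bbar :: "real^'m^'n" and K :: "real^'n^'m"
  assumes "X \<omega> = chaos_sum (Pow {..<k}) c \<omega>"
    and "V \<omega> = chaos_sum (Pow {..<k}) (\<lambda>S. if age d start k S = d then - (K *v c S) else 0) \<omega>"
  shows "plant_step w A Abar B Bbar k X V \<omega> =
    chaos_sum (Pow {..<Suc k}) (chaos_step d (mode d A B K) (mode d Abar Bbar K) start k c) \<omega>"
proof -
  have eq: "R *v c S + T *v (if age d start k S = d then - (K *v c S) else 0) =
      mode d R T K (age d start k S) *v c S" for R :: "real^'n^'n" and T :: "real^'m^'n" and S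
    using age_le[of d start k S]
    by (auto simp: mode_def matrix_vector_mult_diff_rdistrib matrix_vector_mul_assoc[symmetric]
        linear_neg[OF matrix_vector_mul_linear])
  have "plant_step w A Abar B Bbar k X V \<omega> =
      (A *v X \<omega> + B *v V \<omega>) + w k \<omega> *\<^sub>R (Abar *v X \<omega> + Bbar *v V \<omega>)"
    by (simp add: plant_step_def matrix_vector_mult_add_rdistrib scaleR_matrix_vector_assoc[symmetric]
        scaleR_add_right)
  then show ?thesis
    unfolding assms matrix_chaos_sum chaos_sum_add eq chaos_sum_step .
qed

lemma measurable_vec_cond_exp: "vec_cond_exp M (\<F> m) X \<in> borel_measurable M"
proof -
  have "(\<lambda>\<omega>. vec_cond_exp M (\<F> m) X \<omega> \<bullet> b) \<in> borel_measurable M" if b_basis: "b \<in> Basis" for b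
  proof -
    obtain i where b: "b = axis i 1" using b_basis unfolding Basis_vec_def Basis_real_def by blast
    have "real_cond_exp M (\<F> m) (\<lambda>\<omega>. X \<omega> $ i) \<in> borel_measurable M"
      by (rule borel_measurable_cond_exp2)
    then show ?thesis by (simp add: b inner_axis vec_cond_exp_def)
  qed
  then show ?thesis by (rule borel_measurable_euclidean_space[THEN iffD2, rule_format])
qed

lemma measurable_matrix_vector: "X \<in> borel_measurable M \<Longrightarrow> (\<lambda>\<omega>. R *v X \<omega>) \<in> borel_measurable M"
  for X :: "'a \<Rightarrow> real^'k"
  by (rule borel_measurable_continuous_on[OF linear_continuous_on[OF matrix_vector_mul_bounded_linear]])

lemma measurable_plant_step:
  assumes "X \<in> borel_measurable M" "V \<in> borel_measurable M"
  shows "plant_step w A Abar B Bbar k X V \<in> borel_measurable M"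
proof -
  have "plant_step w A Abar B Bbar k X V =
      (\<lambda>\<omega>. A *v X \<omega> + w k \<omega> *\<^sub>R (Abar *v X \<omega>) + (B *v V \<omega> + w k \<omega> *\<^sub>R (Bbar *v V \<omega>)))"
    by (simp add: plant_step_def fun_eq_iff matrix_vector_mult_add_rdistrib scaleR_matrix_vector_assoc)
  also have "\<dots> \<in> borel_measurable M"
    by (intro borel_measurable_add borel_measurable_scaleR measurable_matrix_vector assms measurable_noise)
  finally show ?thesis .
qed

lemma measurable_delayed_feedback: "delayed_feedback M w d K k X \<in> borel_measurable M"
  unfolding delayed_feedback_def
  by (intro borel_measurable_uminus measurable_matrix_vector measurable_vec_cond_exp)

lemma delayed_feedback_chaos_sum:
  assumes X: "X \<in> borel_measurable M" "AE \<omega> in M. X \<omega> = chaos_sum (Pow {..<k}) c \<omega>" and k: "d \<le> k"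
  shows "AE \<omega> in M. delayed_feedback M w d K k X \<omega> =
    chaos_sum (Pow {..<k}) (\<lambda>S. if age d start k S = d then - (K *v c S) else 0) \<omega>"
proof -
  have "AE \<omega> in M. vec_cond_exp M (\<F> (int k - int d - 1)) X \<omega> =
      chaos_sum (Pow {..<k}) (\<lambda>S. if \<forall>s\<in>S. int s \<le> int k - int d - 1 then c S else 0) \<omega>"
    by (rule cond_exp_chaos_sum[OF X]) (auto intro: finite_subset)
  then show ?thesis
  proof eventually_elim
    case (elim \<omega>)
    show ?case
      unfolding delayed_feedback_def elim matrix_chaos_sum
      unfolding chaos_sum_def sum_negf[symmetric]
      by (intro sum.cong) (auto simp: age_eq_delay_iff k)
  qed
qed

text \<open>\<open>start\<close> may be arbitrary here: from time \<open>j\<close> on, the mean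
  component already has age \<open>d\<close>.\<close>

lemma closed_loop_from_chaos_sum:
  fixes A Abar :: "real^'n^'n" and B Bbar :: "real^'m^'n" and K :: "real^'n^'m"
    and d j :: nat and \<xi> :: "'a \<Rightarrow> real^'n"
  assumes \<xi>: "\<xi> \<in> borel_measurable M" "AE \<omega> in M. \<xi> \<omega> = chaos_sum (Pow {..<j}) c \<omega>" and j: "d \<le> j"
  defines "X \<equiv> closed_loop_from M w d A Abar B Bbar K j \<xi>"
  shows "X t \<in> borel_measurable M \<and> (AE \<omega> in M. X t \<omega> =
    chaos_sum (Pow {..<j + t}) (chaos_coeff d (mode d A B K) (mode d Abar Bbar K) start j c t) \<omega>)"
proof (induction t)
  case 0
  then show ?case using \<xi> by (simp add: X_def)
next
  case (Suc t)
  let ?c = "chaos_coeff d (mode d A B K) (mode d Abar Bbar K) start j c t"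
  have step: "X (Suc t) = plant_step w A Abar B Bbar (j + t) (X t) (delayed_feedback M w d K (j + t) (X t))"
    by (simp add: X_def)
  have "AE \<omega> in M. delayed_feedback M w d K (j + t) (X t) \<omega> =
      chaos_sum (Pow {..<j + t}) (\<lambda>S. if age d start (j + t) S = d then - (K *v ?c S) else 0) \<omega>"
    using Suc j by (intro delayed_feedback_chaos_sum) auto
  with Suc[THEN conjunct2] have "AE \<omega> in M. X (Suc t) \<omega> =
      chaos_sum (Pow {..<Suc (j + t)}) (chaos_step d (mode d A B K) (mode d Abar Bbar K) start (j + t) ?c) \<omega>"
    unfolding step by eventually_elim (rule plant_step_chaos_sum)
  moreover have "X (Suc t) \<in> borel_measurable M"
    unfolding step using Suc by (intro measurable_plant_step measurable_delayed_feedback) auto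
  ultimately show ?case by simp
qed

text \<open>During the first \<^term>\<open>d\<close> steps the input is free.  Choosing it as zero while the age of the
  initial state is below \<^term>\<open>d\<close>, and as the feedback of the mean state afterwards, makes a
  deterministic initial state behave like a component of any prescribed age.\<close>

lemma closed_loop_chaos_sum:
  fixes A Abar :: "real^'n^'n" and B Bbar :: "real^'m^'n" and K :: "real^'n^'m" and x :: "real^'n"
    and d start :: nat
  defines "c \<equiv> chaos_coeff d (mode d A B K) (mode d Abar Bbar K) start 0 (\<lambda>S. if S = {} then x else 0)"
  defines "u \<equiv> \<lambda>t. if min (start + nat (t + int d)) d = d then - (K *v c (nat (t + int d)) {}) else 0"
  defines "X \<equiv> closed_loop M w d A Abar B Bbar K x u"
  shows "X k \<in> borel_measurable M \<and> (AE \<omega> in M. X k \<omega> = chaos_sum (Pow {..<k}) (c k) \<omega>)"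
proof (induction k)
  case 0
  then show ?case by (simp add: X_def c_def chaos_sum_def chaos_def)
next
  case (Suc k)
  define V where "V = (if k < d then (\<lambda>_. u (int k - int d)) else delayed_feedback M w d K k (X k))"
  have step: "X (Suc k) = plant_step w A Abar B Bbar k (X k) V"
    by (simp add: X_def V_def)
  have V: "V \<in> borel_measurable M"
    by (auto simp: V_def intro: measurable_delayed_feedback)
  have "AE \<omega> in M. V \<omega> = chaos_sum (Pow {..<k}) (\<lambda>S. if age d start k S = d then - (K *v c k S) else 0) \<omega>"
  proof (cases "k < d")
    case True
    \<comment> \<open>Before time \<open>d\<close> every noisy component is too young to be fed
      back, so only the mean remains, and a deterministic input can reproduce it. Adding
      \<open>d\<close> to the negative input index in \<open>u\<close> recovers the time
      \<open>k\<close>.\<close>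
    have "chaos_sum (Pow {..<k}) (\<lambda>S. if age d start k S = d then - (K *v c k S) else 0) \<omega> =
        (\<Sum>S\<in>{{}}. chaos S \<omega> *\<^sub>R (if age d start k S = d then - (K *v c k S) else 0))" for \<omega>
      unfolding chaos_sum_def
    proof (rule sum.mono_neutral_right)
      show "\<forall>S\<in>Pow {..<k} - {{}}. chaos S \<omega> *\<^sub>R (if age d start k S = d then - (K *v c k S) else 0) = 0"
        using age_less_delay[OF _ True, of _ start] by (metis DiffD2 less_irrefl scaleR_zero_right singletonI)
    qed auto
    then show ?thesis
      using True by (simp add: V_def u_def chaos_def age_def)
  next
    case False
    then show ?thesis
      unfolding V_def using Suc by (simp add: delayed_feedback_chaos_sum)
  qed
  with Suc[THEN conjunct2] have "AE \<omega> in M. X (Suc k) \<omega> =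
      chaos_sum (Pow {..<Suc k}) (chaos_step d (mode d A B K) (mode d Abar Bbar K) start k (c k)) \<omega>"
    unfolding step by eventually_elim (rule plant_step_chaos_sum)
  moreover have "X (Suc k) \<in> borel_measurable M"
    unfolding step using Suc V by (intro measurable_plant_step) auto
  ultimately show ?case by (simp add: c_def)
qed

section \<open>Transfer of stability and observability to the operator\<close>

text \<open>With the input that gives the initial state age \<open>i\<close>, Parseval and duality
  identify the second moment at time \<open>k\<close> with the \<open>k\<close>-th iterate at
  \<open>i\<close> and \<open>x\<close>.\<close>

lemma stable_lyapunov_decay:
  fixes A Abar :: "real^'n^'n" and B Bbar :: "real^'m^'n" and K :: "real^'n^'m"
  assumes "asymp_ms_stable M w d A Abar B Bbar K" "i \<le> d"
  shows "(\<lambda>t. (lyap_form d (mode d A B K) (mode d Abar Bbar K) ^^ t) (\<lambda>i x. x \<bullet> x) i x) \<longlonglongrightarrow> 0"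
proof -
  let ?F = "mode d A B K" and ?G = "mode d Abar Bbar K"
  define c where "c = chaos_coeff d ?F ?G i 0 (\<lambda>S. if S = {} then x else 0)"
  obtain u where X: "\<And>k. closed_loop M w d A Abar B Bbar K x u k \<in> borel_measurable M"
    "\<And>k. AE \<omega> in M. closed_loop M w d A Abar B Bbar K x u k \<omega> = chaos_sum (Pow {..<k}) (c k) \<omega>"
    using closed_loop_chaos_sum[where d = d and A = A and Abar = Abar and B = B and Bbar = Bbar and K = K
        and start = i and x = x] unfolding c_def by blast
  have moment: "(\<integral>\<omega>. closed_loop M w d A Abar B Bbar K x u k \<omega> \<bullet> closed_loop M w d A Abar B Bbar K x u k \<omega> \<partial>M) =
      (lyap_form d ?F ?G ^^ k) (\<lambda>i x. x \<bullet> x) i x" for k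
  proof -
    have "(\<integral>\<omega>. closed_loop M w d A Abar B Bbar K x u k \<omega> \<bullet> closed_loop M w d A Abar B Bbar K x u k \<omega> \<partial>M) =
        (\<integral>\<omega>. chaos_sum (Pow {..<k}) (c k) \<omega> \<bullet> chaos_sum (Pow {..<k}) (c k) \<omega> \<partial>M)"
      using X(2)[of k] by (intro integral_cong_AE borel_measurable_inner X(1) measurable_chaos_sum) auto
    also have "\<dots> = (\<Sum>S\<in>Pow {..<k}. c k S \<bullet> c k S)"
      by (intro second_moment_chaos_sum) (auto intro: finite_subset)
    also have "\<dots> = energy d (\<lambda>i x. x \<bullet> x) i (0 + k) (c k)"
      by (simp add: energy_def)
    also have "\<dots> = energy d ((lyap_form d ?F ?G ^^ k) (\<lambda>i x. x \<bullet> x)) i 0 (\<lambda>S. if S = {} then x else 0)"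
      unfolding c_def by (rule energy_chaos_coeff)
    also have "\<dots> = (lyap_form d ?F ?G ^^ k) (\<lambda>i x. x \<bullet> x) (age d i 0 {}) x"
      by (intro energy_single lyap_form_funpow_zero) auto
    finally show ?thesis using assms(2) by (simp add: age_def)
  qed
  show ?thesis
    using assms(1)[unfolded asymp_ms_stable_def, rule_format, of x u] unfolding moment .
qed

text \<open>A component of age \<^term>\<open>i\<close> below the delay is realised at time \<^term>\<open>d\<close> by the random state
  $w_{d-1-i}\,x$, and the predicted component by the constant state $x$.\<close>

lemma observable_component:
  fixes A Abar :: "real^'n^'n" and B Bbar :: "real^'m^'n" and K :: "real^'n^'m"
  assumes obs: "exactly_observable M w d A Abar B Bbar K (psd_sqrt Q)" and Q: "pos_semidef Q"
    and i: "i \<le> d"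
    and unseen: "\<And>t. (lyap_form d (mode d A B K) (mode d Abar Bbar K) ^^ t) (\<lambda>_ x. x \<bullet> (Q *v x)) i x = 0"
  shows "x = 0"
proof -
  let ?F = "mode d A B K" and ?G = "mode d Abar Bbar K"
  \<comment> \<open>At time \<open>d\<close> the set \<open>{d - 1 - i}\<close> has age
    \<open>d - 1 - (d - 1 - i) = i\<close>; age \<open>d\<close> needs the empty set.\<close>
  define T where "T = (if i = d then {} else {d - 1 - i})"
  define \<xi> where "\<xi> \<omega> = chaos T \<omega> *\<^sub>R x" for \<omega>
  define c where "c = chaos_coeff d ?F ?G 0 d (\<lambda>S. if S = T then x else 0)"
  let ?X = "closed_loop_from M w d A Abar B Bbar K d \<xi>"
  have T: "T \<subseteq> {..<d}" "finite T" "age d 0 d T = i"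
    using i by (auto simp: T_def age_def)
  have "\<xi> = chaos_sum (Pow {..<d}) (\<lambda>S. if S = T then x else 0)"
  proof
    fix \<omega>
    have "chaos_sum (Pow {..<d}) (\<lambda>S. if S = T then x else 0) \<omega> =
        (\<Sum>S\<in>Pow {..<d}. if S = T then chaos T \<omega> *\<^sub>R x else 0)"
      unfolding chaos_sum_def by (intro sum.cong) auto
    then show "\<xi> \<omega> = chaos_sum (Pow {..<d}) (\<lambda>S. if S = T then x else 0) \<omega>"
      using T(1) by (simp add: \<xi>_def)
  qed
  then have X: "?X t \<in> borel_measurable M \<and> (AE \<omega> in M. ?X t \<omega> = chaos_sum (Pow {..<d + t}) (c t) \<omega>)" for t
    unfolding c_def by (intro closed_loop_from_chaos_sum) auto
  have "\<xi> \<in> borel_measurable (\<F> (int d - 1))"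
    unfolding \<xi>_def[abs_def] using T(1)
    by (intro borel_measurable_scaleR measurable_chaos_filtration borel_measurable_const) auto
  moreover have "integrable M (\<lambda>\<omega>. (norm (\<xi> \<omega>))\<^sup>2)"
    using integrable_chaos_product[OF T(2) T(2)]
    by (simp add: \<xi>_def power_mult_distrib power2_eq_square[of "chaos T _"])
  moreover have "AE \<omega> in M. psd_sqrt Q *v ?X t \<omega> = 0" for t
  proof -
    \<comment> \<open>By duality the vanishing iterate is a sum of nonnegative output costs over all
      components, so each of them vanishes.\<close>
    have "0 = energy d ((lyap_form d ?F ?G ^^ t) (\<lambda>_ x. x \<bullet> (Q *v x))) 0 d (\<lambda>S. if S = T then x else 0)"
      using unseen T by (simp add: energy_single lyap_form_funpow_zero)
    also have "\<dots> = energy d (\<lambda>_ x. x \<bullet> (Q *v x)) 0 (d + t) (c t)"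
      unfolding c_def by (rule energy_chaos_coeff[symmetric])
    finally have "(\<Sum>S\<in>Pow {..<d + t}. c t S \<bullet> (Q *v c t S)) = 0"
      by (simp add: energy_def)
    then have "\<forall>S\<in>Pow {..<d + t}. c t S \<bullet> (Q *v c t S) = 0"
      using Q by (subst (asm) sum_nonneg_eq_0_iff) (auto simp: pos_semidef_def)
    then have "psd_sqrt Q *v c t S = 0" if "S \<in> Pow {..<d + t}" for S
      using psd_sqrt_vector_eq_0[OF Q] that by blast
    then have "psd_sqrt Q *v chaos_sum (Pow {..<d + t}) (c t) \<omega> = 0" for \<omega>
      unfolding matrix_chaos_sum unfolding chaos_sum_def by simp
    with X[of t] show ?thesis by auto
  qed
  ultimately have "AE \<omega> in M. \<xi> \<omega> = 0"
    using obs unfolding exactly_observable_def by blast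
  \<comment> \<open>The second moment of \<open>chaos T\<close> is 1, so the product can vanish
    almost surely only for \<open>x = 0\<close>.\<close>
  then have "AE \<omega> in M. chaos T \<omega> * chaos T \<omega> * (x \<bullet> x) = 0"
    by eventually_elim (auto simp: \<xi>_def)
  then have "(\<integral>\<omega>. chaos T \<omega> * chaos T \<omega> * (x \<bullet> x) \<partial>M) = 0"
    by (rule integral_eq_zero_AE)
  then show "x = 0"
    using integral_chaos_product[OF T(2) T(2)] by simp
qed

end

theorem lemma6:
  fixes M :: "'a measure" and w :: "nat \<Rightarrow> 'a \<Rightarrow> real" and d :: nat
    and A Abar Q :: "real^'n^'n" and B Bbar :: "real^'m^'n" and K :: "real^'n^'m"
  assumes "white_noise M w"
    and "1 \<le> d"
    and "pos_semidef Q"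
    and "exactly_observable M w d A Abar B Bbar K (psd_sqrt Q)"
    and "asymp_ms_stable M w d A Abar B Bbar K"
  shows "\<exists>!P. P \<in> {0..d} \<rightarrow>\<^sub>E {S. pos_def S} \<and> lyapunov_equations d A Abar B Bbar K Q P"
proof -
  interpret white_noise_space M w by (rule white_noise_spaceI) fact
  let ?F = "mode d A B K" and ?G = "mode d Abar Bbar K"
  interpret lyapunov_stable d ?F ?G
    by unfold_locales (rule stable_lyapunov_decay[OF assms(5)])
  obtain P where sym: "\<And>i. transpose (P i) = P i"
    and eq: "\<And>i. i \<le> d \<Longrightarrow> P i = lyap_matrix d ?F ?G P i + Q"
    and lower: "\<And>t. form_le d ((\<Lambda> ^^ t) (form_of (\<lambda>_. Q))) (form_of P)"
    using lyapunov_solution_exists[OF assms(3)] by blast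
  have Q: "0 \<le> x \<bullet> (Q *v x)" for x using assms(3) by (simp add: pos_semidef_def)
  have form_Q: "form_of (\<lambda>_. Q) = (\<lambda>_ x. x \<bullet> (Q *v x))" by (intro ext) (simp add: form_of_def)
  have nonneg: "0 \<le> (\<Lambda> ^^ t) (\<lambda>_ x. x \<bullet> (Q *v x)) i x" for t i x
    by (induction t arbitrary: i x) (auto simp: Q lyap_form_def)
  have pos: "pos_def (P i)" if i: "i \<le> d" for i
    unfolding pos_def_def
  proof (intro conjI allI impI sym)
    fix x assume "x \<noteq> (0 :: real^'n)"
    then obtain t where "(\<Lambda> ^^ t) (\<lambda>_ x. x \<bullet> (Q *v x)) i x \<noteq> 0"
      using observable_component[OF assms(4,3) i] by blast
    then have "0 < (\<Lambda> ^^ t) (\<lambda>_ x. x \<bullet> (Q *v x)) i x"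
      using nonneg[of t i x] by simp
    also have "\<dots> \<le> x \<bullet> (P i *v x)"
      using lower[of t] i by (simp add: form_le_def form_Q) (simp add: form_of_def)
    finally show "0 < x \<bullet> (P i *v x)" .
  qed
  show ?thesis
  proof (rule ex1I[of _ "restrict P {0..d}"])
    \<comment> \<open>The operator reads only the indices 0 and \<open>min (Suc i) d\<close>, which
      survive the restriction; restricting fixes the values beyond \<open>d\<close>, as unique
      existence of a function demands.\<close>
    have "lyap_matrix d ?F ?G (restrict P {0..d}) i = lyap_matrix d ?F ?G P i" for i
      by (simp add: lyap_matrix_def)
    then show "restrict P {0..d} \<in> {0..d} \<rightarrow>\<^sub>E {S. pos_def S} \<and>
        lyapunov_equations d A Abar B Bbar K Q (restrict P {0..d})"
      unfolding lyapunov_equations_iff using pos eq by auto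
  next
    fix P' assume P': "P' \<in> {0..d} \<rightarrow>\<^sub>E {S. pos_def S} \<and> lyapunov_equations d A Abar B Bbar K Q P'"
    have "P' i = P i" if "i \<le> d" for i
    proof (rule lyapunov_solution_unique[OF _ _ sym eq that])
      show "P' i = lyap_matrix d ?F ?G P' i + Q" if "i \<le> d" for i
        using P' that unfolding lyapunov_equations_iff by blast
      show "transpose (P' i) = P' i" if "i \<le> d" for i
      proof -
        have "P' i \<in> {S. pos_def S}" using P' that by (auto intro: PiE_mem)
        then show ?thesis by (simp add: pos_def_def)
      qed
    qed
    then show "P' = restrict P {0..d}"
      using P' by (intro extensionalityI[of _ "{0..d}"]) (auto simp: PiE_def)
  qed
qed

end
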